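(* Let $G$ be a graph on $n \geqslant 18$ vertices. If $\mu(G) \geqslant \mu\left(K_{n} \backslash E(S_{n-3})\right)$, then $G$ contains the $2$-power of a Hamilton cycle unless $G=K_{n} \backslash E(S_{n-3})$. *)

theory Defs
  imports "Graph_Theory.Graph_Theory" "Jordan_Normal_Form.Spectral_Radius"
begin

text \<open>
  Finite simple graphs are the symmetric loop-free digraphs \<^locale>\<open>pair_graph\<close>: an undirected
  edge \<open>uv\<close> is the pair of arcs \<open>(u, v)\<close>, \<open>(v, u)\<close>.
\<close>

subsection \<open>Graphs\<close>

definition complete_graph :: "nat \<Rightarrow> nat pair_pre_digraph" where
  "complete_graph n = \<lparr> pverts = {..<n}, parcs = {(i, j). i < n \<and> j < n \<and> i \<noteq> j} \<rparr>"

text \<open>The star \<open>S\<^sub>m\<close> has \<open>m\<close> vertices, that is \<open>m - 1\<close> edges; its centre is \<open>0\<close>.\<close>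

definition star_graph :: "nat \<Rightarrow> nat pair_pre_digraph" where
  "star_graph m = \<lparr> pverts = {..<m},
     parcs = {(i, j). i < m \<and> j < m \<and> (i = 0 \<or> j = 0) \<and> i \<noteq> j} \<rparr>"

text \<open>A cycle only for \<open>n \<ge> 3\<close>.\<close>

definition cycle_graph :: "nat \<Rightarrow> nat pair_pre_digraph" where
  "cycle_graph n = \<lparr> pverts = {..<n},
     parcs = {(i, j). i < n \<and> j < n \<and> (j = (i + 1) mod n \<or> i = (j + 1) mod n)} \<rparr>"

definition delete_edges :: "'a pair_pre_digraph \<Rightarrow> 'a rel \<Rightarrow> 'a pair_pre_digraph" where
  "delete_edges G F = \<lparr> pverts = pverts G, parcs = parcs G - F \<rparr>"

definition graph_isomorphic :: "'a pair_pre_digraph \<Rightarrow> 'b pair_pre_digraph \<Rightarrow> bool" where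
  "graph_isomorphic G H \<longleftrightarrow> digraph_iso (with_proj G) (with_proj H)"

text \<open>
  Distinct vertices are joined in the \<open>k\<close>-power iff their distance in \<open>G\<close> is at most \<open>k\<close>, i.e. iff
  some walk of length at most \<open>k\<close> connects them.
\<close>

definition graph_power :: "nat \<Rightarrow> 'a pair_pre_digraph \<Rightarrow> 'a pair_pre_digraph" where
  "graph_power k G = \<lparr> pverts = pverts G,
     parcs = {(u, v). u \<noteq> v \<and> (\<exists>p. pre_digraph.awalk (with_proj G) u p v \<and> length p \<le> k)} \<rparr>"

definition hamilton_cycle :: "'a pair_pre_digraph \<Rightarrow> 'a pair_pre_digraph \<Rightarrow> bool" where
  "hamilton_cycle C G \<longleftrightarrow>
     spanning (with_proj C) (with_proj G) \<and>
     3 \<le> card (pverts G) \<and> graph_isomorphic C (cycle_graph (card (pverts G)))"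

definition contains_power_of_hamilton_cycle :: "nat \<Rightarrow> 'a pair_pre_digraph \<Rightarrow> bool" where
  "contains_power_of_hamilton_cycle k G \<longleftrightarrow>
     (\<exists>C. hamilton_cycle C G \<and> spanning (with_proj (graph_power k C)) (with_proj G))"

subsection \<open>Largest adjacency eigenvalue\<close>

definition adjacency_matrix :: "'a list \<Rightarrow> 'a pair_pre_digraph \<Rightarrow> real mat" where
  "adjacency_matrix vs G =
     mat (length vs) (length vs) (\<lambda>(i, j). if (vs ! i, vs ! j) \<in> parcs G then 1 else 0)"

definition vertex_enumeration :: "'a list \<Rightarrow> 'a pair_pre_digraph \<Rightarrow> bool" where
  "vertex_enumeration vs G \<longleftrightarrow> distinct vs \<and> set vs = pverts G"

text \<open>
  \<open>\<mu>(G)\<close>. The enumeration chosen is immaterial (\<open>graph_mu_eq\<close> below). The spectrum consists of the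
  real eigenvalues, which are all the eigenvalues since the matrix is symmetric.
\<close>

definition graph_mu :: "'a pair_pre_digraph \<Rightarrow> real" where
  "graph_mu G = Max (spectrum (adjacency_matrix (SOME vs. vertex_enumeration vs G) G))"

lemma spectrum_adjacency_matrix_subset:
  assumes vs: "vertex_enumeration vs G" and ws: "vertex_enumeration ws G"
  shows "spectrum (adjacency_matrix vs G) \<subseteq> spectrum (adjacency_matrix ws G)"
proof
  fix c assume "c \<in> spectrum (adjacency_matrix vs G)"
  then obtain x where x: "x \<in> carrier_vec (length vs)" "x \<noteq> 0\<^sub>v (length vs)"
    and eig: "adjacency_matrix vs G *\<^sub>v x = c \<cdot>\<^sub>v x"
    unfolding spectrum_def eigenvalue_def eigenvector_def by (auto simp: adjacency_matrix_def)
  define n where "n = length vs"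
  have dvs: "distinct vs" and dws: "distinct ws" and sets: "set vs = set ws"
    using vs ws by (auto simp: vertex_enumeration_def)
  have lenw: "length ws = n"
    using dvs dws sets unfolding n_def by (metis distinct_card)
  define p where "p i = the_inv_into {..<n} ((!) vs) (ws ! i)" for i
  have bv: "bij_betw ((!) vs) {..<n} (set vs)"
    using bij_betw_nth[OF dvs, of "{..<n}" "set vs"] by (simp add: n_def)
  have bw: "bij_betw ((!) ws) {..<n} (set ws)"
    using bij_betw_nth[OF dws, of "{..<n}" "set ws"] by (simp add: lenw)
  have bp: "bij_betw p {..<n} {..<n}"
    using bij_betw_trans[OF bw[folded sets] bij_betw_the_inv_into[OF bv]]
    by (simp add: p_def[abs_def] o_def)
  have pn: "p i < n" if "i < n" for i
    using bp that by (auto simp: bij_betw_def)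
  have vp: "vs ! p i = ws ! i" if "i < n" for i
    unfolding p_def using bv sets that lenw
    by (intro f_the_inv_into_f) (auto simp: bij_betw_def)
  define y where "y = vec n (\<lambda>i. x $ p i)"
  have row: "(\<Sum>j<n. (if (vs ! i, vs ! j) \<in> parcs G then 1 else 0) * x $ j) = c * x $ i"
    if "i < n" for i
    using arg_cong[OF eig, of "\<lambda>v. v $ i"] that x(1)
    by (simp add: adjacency_matrix_def n_def scalar_prod_def atLeast0LessThan)
  have "adjacency_matrix ws G *\<^sub>v y = c \<cdot>\<^sub>v y"
  proof (rule eq_vecI)
    show "dim_vec (adjacency_matrix ws G *\<^sub>v y) = dim_vec (c \<cdot>\<^sub>v y)"
      by (simp add: adjacency_matrix_def y_def lenw)
    fix i assume "i < dim_vec (c \<cdot>\<^sub>v y)"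
    then have i: "i < n" by (simp add: y_def)
    have "(adjacency_matrix ws G *\<^sub>v y) $ i =
        (\<Sum>j<n. (if (ws ! i, ws ! j) \<in> parcs G then 1 else 0) * x $ p j)"
      using i by (simp add: adjacency_matrix_def y_def lenw scalar_prod_def atLeast0LessThan)
    also have "\<dots> = (\<Sum>j<n. (if (vs ! p i, vs ! p j) \<in> parcs G then 1 else 0) * x $ p j)"
      using i by (intro sum.cong) (auto simp: vp)
    also have "\<dots> = (\<Sum>j<n. (if (vs ! p i, vs ! j) \<in> parcs G then 1 else 0) * x $ j)"
      by (rule sum.reindex_bij_betw[OF bp])
    also have "\<dots> = c * x $ p i" by (rule row[OF pn[OF i]])
    finally show "(adjacency_matrix ws G *\<^sub>v y) $ i = (c \<cdot>\<^sub>v y) $ i"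
      using i by (simp add: y_def)
  qed
  moreover have "y \<noteq> 0\<^sub>v n"
  proof
    assume y0: "y = 0\<^sub>v n"
    have "x = 0\<^sub>v n"
    proof (rule eq_vecI)
      fix k assume "k < dim_vec (0\<^sub>v n :: real vec)"
      then have k: "k < n" by simp
      then obtain i where i: "i < n" "k = p i" using bp by (auto simp: bij_betw_def)
      have "y $ i = 0" using y0 i(1) by simp
      then show "x $ k = (0\<^sub>v n :: real vec) $ k"
        using i k by (simp add: y_def)
    qed (use x n_def in simp)
    then show False using x(2) n_def by simp
  qed
  moreover have "y \<in> carrier_vec n" by (simp add: y_def)
  ultimately show "c \<in> spectrum (adjacency_matrix ws G)"
    unfolding spectrum_def eigenvalue_def eigenvector_def
    by (auto simp: adjacency_matrix_def lenw intro!: exI[of _ y])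
qed

lemma graph_mu_eq:
  assumes "vertex_enumeration vs G"
  shows "graph_mu G = Max (spectrum (adjacency_matrix vs G))"
proof -
  have "vertex_enumeration (SOME vs. vertex_enumeration vs G) G"
    using assms by (rule someI)
  then show ?thesis
    unfolding graph_mu_def
    using assms spectrum_adjacency_matrix_subset by (metis subset_antisym)
qed

end

theory Submission
  imports Defs
begin

text \<open>
  Put \<open>N = n - 1\<close> and let \<open>e\<close> denote degrees in the complement \<open>H\<close> of \<open>G\<close>. The eigenvalue hypothesis
  gives \<open>\<mu>(G) > N - 1\<close>. If some positive vector \<open>z\<close> satisfied \<open>A z \<le> (N - 1) z\<close>, then
  \<open>\<mu>(G) \<le> N - 1\<close>; explicit vectors \<open>z\<close> therefore show that \<open>H\<close> has at most \<open>N - 1\<close> edges and that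
  \<open>\<Sum>e (N - e) < N\<^sup>2\<close>. If some \<open>e\<close> is at least \<open>N - 3\<close>, then \<open>G\<close> is a connected spanning subgraph of
  the extremal graph, and comparison with the Perron vector of the latter forces equality.

  Otherwise all \<open>e \<le> N - 4\<close>, and the inequality leaves few vertices of large complement degree. When
  several of them have \<open>e \<ge> 4\<close>, there are many vertices isolated in \<open>H\<close>, and a square cycle through the
  top degree vertices (at most four of them) and the isolated ones exists. The remaining vertices are
  inserted in order of increasing \<open>e\<close>; a vertex with fewer than \<open>m / 4\<close> conflicts fits into some gap
  of a square cycle of length \<open>m\<close>.
\<close>

section \<open>Square cycles avoiding a conflict relation\<close>

text \<open>The square of a Hamilton cycle on \<open>C\<close>, given as a cyclic order.
  \<open>R\<close> plays the part of non-adjacency, so that conflicts can be counted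
  directly.\<close>

definition square_cyclic :: "('a \<Rightarrow> 'a \<Rightarrow> bool) \<Rightarrow> 'a set \<Rightarrow> bool" where
  "square_cyclic R C \<longleftrightarrow> (\<exists>f. bij_betw f {..<card C} C \<and>
     (\<forall>i<card C. \<not> R (f i) (f ((i + 1) mod card C)) \<and> \<not> R (f i) (f ((i + 2) mod card C))))"

lemma square_cyclic_independent:
  assumes "finite I" and "\<And>x y. x \<in> I \<Longrightarrow> y \<in> I \<Longrightarrow> \<not> R x y"
  shows "square_cyclic R I"
proof -
  obtain f where f: "bij_betw f {..<card I} I"
    using ex_bij_betw_nat_finite[OF assms(1)] by (auto simp: atLeast0LessThan)
  have "f j \<in> I" if "j < card I" for j
    using bij_betwE[OF f] that by simp
  then have "\<not> R (f i) (f (j mod card I))" if "i < card I" for i j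
    by (metis assms(2) that mod_less_divisor bot_nat_0.not_eq_extremum not_less_zero)
  then show ?thesis
    using f unfolding square_cyclic_def by blast
qed

lemma card_shift_mod_le:
  fixes P :: "nat set"
  assumes "finite P"
  shows "card {k. k < m \<and> (k + d) mod m \<in> P} \<le> card P"
proof (rule card_inj_on_le[of "\<lambda>k. (k + d) mod m"])
  have *: "a = b" if "a \<le> b" "b < m" "(a + d) mod m = (b + d) mod m" for a b
  proof -
    have "m dvd (b + d) - (a + d)"
      using that by (metis mod_eq_dvd_iff_nat add_le_mono1)
    then show ?thesis
      using that nat_dvd_not_less[of "b - a" m] by (cases "a = b") auto
  qed
  show "inj_on (\<lambda>k. (k + d) mod m) {k. k < m \<and> (k + d) mod m \<in> P}"
    by (intro inj_onI) (metis (mono_tags, lifting) * mem_Collect_eq nat_le_linear)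
qed (use assms in auto)

text \<open>Each conflict of \<open>x\<close> spoils four of the \<open>card C\<close> gaps of the cycle, so some gap remains.\<close>

lemma square_cyclic_insert:
  assumes fin: "finite C" and C: "4 \<le> card C" and x: "x \<notin> C"
    and sym: "\<And>a b. R a b \<Longrightarrow> R b a"
    and few: "4 * card {y \<in> C. R x y} < card C"
    and C_sq: "square_cyclic R C"
  shows "square_cyclic R (insert x C)"
proof -
  define m where "m = card C"
  obtain f where f: "bij_betw f {..<m} C"
    and f1: "\<And>i. i < m \<Longrightarrow> \<not> R (f i) (f ((i + 1) mod m))"
    and f2: "\<And>i. i < m \<Longrightarrow> \<not> R (f i) (f ((i + 2) mod m))"
    using C_sq unfolding square_cyclic_def m_def by blast
  have m4: "4 \<le> m" using C by (simp add: m_def)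
  define P where "P = {p. p < m \<and> R x (f p)}"
  have "P \<subseteq> {..<m}" by (auto simp: P_def)
  then have finP: "finite P" by (rule finite_subset) simp
  have cardP: "card P \<le> card {y \<in> C. R x y}"
  proof (rule card_inj_on_le[of f])
    show "inj_on f P"
      using f by (auto simp: bij_betw_def P_def intro: inj_on_subset)
    show "f ` P \<subseteq> {y \<in> C. R x y}"
      using bij_betwE[OF f] by (auto simp: P_def)
  qed (use fin in auto)
  \<comment> \<open>Inserting \<open>x\<close> just before position \<open>k\<close> brings the
    positions \<open>k\<close>, \<open>k + 1\<close>, \<open>k - 1\<close>, \<open>k - 2\<close>
    within distance two of it; modulo \<open>m\<close> these are the shifts \<open>0\<close>,
    \<open>1\<close>, \<open>m - 1\<close>, \<open>m - 2\<close>.\<close>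
  define K where "K d = {k. k < m \<and> (k + d) mod m \<in> P}" for d
  have finK: "finite (K d)" for d by (simp add: K_def)
  have cK: "card (K d) \<le> card P" for d
    using card_shift_mod_le[OF finP, of m] by (simp add: K_def)
  have "card (K 0 \<union> K 1 \<union> K (m - 1) \<union> K (m - 2)) \<le> card (K 0) + card (K 1) + card (K (m - 1)) + card (K (m - 2))"
    by (meson card_Un_le add_le_mono1 order_trans)
  also have "\<dots> \<le> 4 * card P"
    using cK[of 0] cK[of 1] cK[of "m - 1"] cK[of "m - 2"] by linarith
  also have "\<dots> < card {..<m}"
    using cardP few by (simp add: m_def)
  finally have "\<not> {..<m} \<subseteq> K 0 \<union> K 1 \<union> K (m - 1) \<union> K (m - 2)"
    using finK by (meson card_mono finite_UnI not_le)
  then obtain k where k: "k < m" "k \<notin> K 0" "k \<notin> K 1" "k \<notin> K (m - 1)" "k \<notin> K (m - 2)"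
    by auto
  \<comment> \<open>The cycle is rotated so that the free gap lies between its last and its first
    vertex; \<open>x\<close> becomes the new last vertex.\<close>
  define g where "g i = (if i < m then f ((i + k) mod m) else x)" for i
  have gx: "\<not> R x (g d)" if "d \<in> {0, 1, m - 1, m - 2}" for d
  proof -
    have "k \<notin> K d" using k that by auto
    moreover have "(k + d) mod m < m" using m4 by simp
    ultimately show ?thesis
      using that m4 k(1) by (auto simp: K_def P_def g_def add.commute)
  qed
  have old: "\<not> R (g i) (g (i + d))" if "d \<in> {1, 2}" "i + d < m" for i d
  proof -
    have "(i + d + k) mod m = ((i + k) mod m + d) mod m"
      by (simp add: mod_add_right_eq ac_simps)
    moreover have "(i + k) mod m < m" using m4 by simp
    ultimately show ?thesis
      using f1[of "(i + k) mod m"] f2[of "(i + k) mod m"] that by (auto simp: g_def)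
  qed
  \<comment> \<open>The only pair of old vertices that straddles \<open>x\<close> at distance two;
    it was consecutive before the insertion.\<close>
  have wrap: "\<not> R (g (m - 1)) (g 0)"
  proof -
    have "k mod m = ((m - 1 + k) mod m + 1) mod m"
      using m4 mod_add_left_eq[of "m - 1 + k" m 1] by simp
    moreover have "(m - 1 + k) mod m < m" using m4 by simp
    ultimately show ?thesis
      using f1[of "(m - 1 + k) mod m"] m4 by (simp add: g_def)
  qed
  have shift: "bij_betw (\<lambda>i. (i + k) mod m) {..<m} {..<m}"
  proof -
    have "inj_on (\<lambda>i. (i + k) mod m) {..<m}"
    proof (rule eq_card_imp_inj_on)
      have "{..<m} \<subseteq> (\<lambda>i. (i + k) mod m) ` {..<m}"
      proof
        fix j assume "j \<in> {..<m}"
        then have "j = ((j + (m - k)) mod m + k) mod m"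
          using k(1) by (simp add: mod_add_left_eq)
        then show "j \<in> (\<lambda>i. (i + k) mod m) ` {..<m}"
          using m4 by (intro image_eqI[of _ _ "(j + (m - k)) mod m"]) auto
      qed
      moreover have "(\<lambda>i. (i + k) mod m) ` {..<m} \<subseteq> {..<m}"
        using m4 by auto
      ultimately show "card ((\<lambda>i. (i + k) mod m) ` {..<m}) = card {..<m}"
        by (metis subset_antisym)
    qed simp
    moreover have "(\<lambda>i. (i + k) mod m) ` {..<m} \<subseteq> {..<m}"
      using m4 by auto
    ultimately show ?thesis
      by (simp add: bij_betw_def endo_inj_surj)
  qed
  have "bij_betw g {..<m} C"
    using bij_betw_trans[OF shift f] by (rule bij_betw_cong[THEN iffD1, rotated]) (simp add: g_def)
  moreover have "g m = x" by (simp add: g_def)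
  ultimately have "bij_betw g ({..<m} \<union> {m}) (C \<union> {x})"
    using x notIn_Un_bij_betw[of m "{..<m}" g C] by simp
  then have g: "bij_betw g {..<Suc m} (insert x C)"
    by (simp add: lessThan_Suc)
  have card': "card (insert x C) = Suc m" using fin x by (simp add: m_def)
  have "\<not> R (g i) (g ((i + 1) mod Suc m)) \<and> \<not> R (g i) (g ((i + 2) mod Suc m))" if i: "i < Suc m" for i
  proof -
    consider "i + 2 < m" | "i = m - 2" | "i = m - 1" | "i = m"
      using i m4 by linarith
    then show ?thesis
    proof cases
      case 1
      then show ?thesis using old[of 1 i] old[of 2 i] by simp
    next
      case 2
      then have "(i + 1) mod Suc m = m - 1" "(i + 2) mod Suc m = m" "i + 1 = m - 1" using m4 by auto
      then show ?thesis using old[of 1 i] gx[of i] sym 2 m4 \<open>g m = x\<close> by auto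
    next
      case 3
      then have "(i + 1) mod Suc m = m" "(i + 2) mod Suc m = 0" using m4 by auto
      then show ?thesis using wrap gx[of i] sym 3 m4 \<open>g m = x\<close> by auto
    next
      case 4
      then have "(i + 1) mod Suc m = 0" "(i + 2) mod Suc m = 1" using m4 by (auto simp: mod_Suc)
      then show ?thesis using gx[of 0] gx[of 1] 4 \<open>g m = x\<close> by auto
    qed
  qed
  then show ?thesis
    using g unfolding square_cyclic_def card' by blast
qed

section \<open>Degrees in the conflict graph and the growth of square cycles\<close>

locale finite_conflict =
  fixes V :: "'a set" and R :: "'a \<Rightarrow> 'a \<Rightarrow> bool"
  assumes finV: "finite V" and R_sym: "R x y \<Longrightarrow> R y x" and R_irrefl: "\<not> R x x"
begin

definition nb :: "'a \<Rightarrow> 'a set" where "nb x = {y \<in> V. R x y}"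

definition dg :: "'a \<Rightarrow> nat" where "dg x = card (nb x)"

lemma finite_nb [simp]: "finite (nb x)"
  using finV by (simp add: nb_def)

text \<open>The remaining vertices are inserted in order of increasing degree.\<close>

lemma square_cyclic_grow:
  assumes "C \<subseteq> V" "4 \<le> card C" "square_cyclic R C"
    and "\<And>x. x \<in> V - C \<Longrightarrow> 4 * dg x < card (C \<union> {y \<in> V. dg y < dg x})"
  shows "square_cyclic R V"
  using assms
proof (induction "card (V - C)" arbitrary: C)
  case 0
  then have "V = C" using finV by auto
  then show ?case using 0 by simp
next
  case (Suc k)
  have finC: "finite C" using Suc.prems(1) finV by (rule finite_subset)
  have fin: "finite (V - C)" using finV by simp
  have "V - C \<noteq> {}" using Suc.hyps(2) by force
  then obtain x where x: "x \<in> V - C" and min: "\<And>y. y \<in> V - C \<Longrightarrow> dg x \<le> dg y"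
    using ex_min_if_finite[of "dg ` (V - C)"] fin by (auto simp: not_less)
  \<comment> \<open>By minimality of \<open>dg x\<close>, every vertex of smaller degree already
    lies in \<open>C\<close>, so the hypothesis bounds \<open>card C\<close> itself.\<close>
  have "C \<union> {y \<in> V. dg y < dg x} = C"
    using min by (auto simp: not_le[symmetric])
  then have deg: "4 * dg x < card C" using Suc.prems(4)[OF x] by simp
  have "card {y \<in> C. R x y} \<le> dg x"
    unfolding dg_def nb_def using Suc.prems(1) finV by (intro card_mono) auto
  then have "square_cyclic R (insert x C)"
    using deg x finC Suc.prems R_sym by (intro square_cyclic_insert) auto
  moreover have "k = card (V - insert x C)"
    using Suc.hyps(2) x fin by (simp add: card_Diff_insert)
  moreover have "4 * dg z < card (insert x C \<union> {y \<in> V. dg y < dg z})" if "z \<in> V - insert x C" for z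
  proof -
    have "card (C \<union> {y \<in> V. dg y < dg z}) \<le> card (insert x C \<union> {y \<in> V. dg y < dg z})"
      using finC finV by (intro card_mono) auto
    then show ?thesis using Suc.prems(4)[of z] that by force
  qed
  moreover have "4 \<le> card (insert x C)"
    using Suc.prems(2) finC x by simp
  ultimately show ?case
    using Suc.hyps(1)[of "insert x C"] x Suc.prems(1) by blast
qed

definition upper :: "nat \<Rightarrow> 'a set" where "upper d = {y \<in> V. d \<le> dg y}"

lemma finite_upper [simp]: "finite (upper d)"
  using finV by (simp add: upper_def)

definition top_set :: "'a set \<Rightarrow> bool" where
  "top_set T \<longleftrightarrow> T \<subseteq> V \<and> (\<forall>x\<in>T. \<forall>y\<in>V - T. dg y \<le> dg x)"

text \<open>When \<open>x\<close> is inserted, only members of \<open>upper (dg x)\<close> can be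
  missing from the cycle, and those in \<open>T\<close> are present. So at least
  \<open>card V - card (upper (dg x)) + card T\<close> vertices are there. For degree at most 1 the
  five initial vertices suffice.\<close>

lemma square_cyclic_grow_top:
  assumes C: "C \<subseteq> V" "5 \<le> card C" "square_cyclic R C"
    and T: "T \<subseteq> C" "top_set T"
    and few: "\<And>x. x \<in> V - C \<Longrightarrow> 2 \<le> dg x \<Longrightarrow> card (upper (dg x)) + 4 * dg x < card V + card T"
  shows "square_cyclic R V"
proof (rule square_cyclic_grow[OF C(1)])
  fix x assume x: "x \<in> V - C"
  have finC: "finite C" using C(1) finV by (rule finite_subset)
  have finT: "finite T" using T(1) finC by (rule finite_subset)
  let ?L = "C \<union> {y \<in> V. dg y < dg x}"
  have finL: "finite ?L" using finC finV by simp
  show "4 * dg x < card ?L"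
  proof (cases "2 \<le> dg x")
    case True
    have Tu: "T \<subseteq> upper (dg x)"
      using T x by (auto simp: top_set_def upper_def)
    have "V \<subseteq> ?L \<union> (upper (dg x) - T)"
      using T(1) by (auto simp: upper_def)
    then have "card V \<le> card (?L \<union> (upper (dg x) - T))"
      using finL by (intro card_mono) auto
    also have "\<dots> \<le> card ?L + card (upper (dg x) - T)"
      by (rule card_Un_le)
    also have "card (upper (dg x) - T) = card (upper (dg x)) - card T"
      using finT Tu by (rule card_Diff_subset)
    finally show ?thesis
      using few[OF x True] card_mono[OF finite_upper Tu] by linarith
  next
    case False
    have "card C \<le> card ?L" using finL by (intro card_mono) auto
    then show ?thesis using False C(2) by linarith
  qed
qed (use C in auto)

text \<open>A vertex of \<open>T\<close> conflicts at most with the members of \<open>T\<close>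
  inserted before it. With \<open>t\<close> of them present, a gap exists when
  \<open>4 * t < card I + t\<close>; the last insertion has \<open>t = card T - 1\<close>, which
  gives the third condition on \<open>T\<close>.\<close>

lemma square_cyclic_isolated_Un:
  assumes I: "I \<subseteq> V" "\<And>x. x \<in> I \<Longrightarrow> nb x = {}" "4 \<le> card I"
    and T: "T \<subseteq> V" "I \<inter> T = {}" "3 * card T \<le> card I + 2"
  shows "square_cyclic R (I \<union> T)"
proof -
  have "finite T" using T(1) finV by (rule finite_subset)
  have finI: "finite I" using I(1) finV by (rule finite_subset)
  have noR: "\<not> R x y" if "x \<in> I" "y \<in> V" for x y
    using I(2)[OF that(1)] that(2) by (auto simp: nb_def)
  from \<open>finite T\<close> T show ?thesis
  proof (induction T rule: finite_induct)
    case empty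
    show ?case using finI noR I(1) by (auto intro!: square_cyclic_independent)
  next
    case (insert x T)
    have "card {y \<in> I \<union> T. R x y} \<le> card T"
      using insert.hyps insert.prems noR R_sym by (intro card_mono) auto
    moreover have "card (I \<union> T) = card I + card T"
      using insert finI by (intro card_Un_disjoint) auto
    ultimately show ?case
      using insert finI I(3) R_sym
      by (auto intro!: square_cyclic_insert[of "I \<union> T" x])
  qed
qed

text \<open>The double sum counts every conflict inside \<open>W\<close> twice, so the number of
  vertices exceeds the number of conflicts by at least \<open>k\<close>. Deleting one end of each
  conflict leaves at least \<open>k\<close> vertices.\<close>

lemma independent_subset_exists:
  assumes "W \<subseteq> V" "(\<Sum>x\<in>W. card {y \<in> W. R x y}) + 2 * k \<le> 2 * card W"
  shows "\<exists>A \<subseteq> W. card A = k \<and> (\<forall>x\<in>A. \<forall>y\<in>A. \<not> R x y)"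
  using assms
proof (induction "card W" arbitrary: W)
  case 0
  then show ?case by (intro exI[of _ "{}"]) auto
next
  case (Suc m)
  have finW: "finite W" using Suc.prems(1) finV by (rule finite_subset)
  show ?case
  proof (cases "\<exists>x\<in>W. \<exists>y\<in>W. R x y")
    case False
    have "k \<le> card W" using Suc.prems(2) by linarith
    then obtain A where "A \<subseteq> W" "card A = k" by (meson obtain_subset_with_card_n)
    then show ?thesis using False by blast
  next
    case True
    then obtain x y where xy: "x \<in> W" "y \<in> W" "R x y" by blast
    then have "x \<noteq> y" using R_irrefl by blast
    let ?W = "W - {x}"
    \<comment> \<open>Removing \<open>x\<close> lowers the sum by its own conflicts and by one more
      at \<open>y\<close>, thus by at least 2, which pays for the lost vertex on the right-hand
      side.\<close>
    have le: "card {z \<in> ?W. R w z} + (if w = y then 1 else 0) \<le> card {z \<in> W. R w z}" for w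
    proof (cases "w = y")
      case True
      have "{z \<in> ?W. R w z} \<subset> {z \<in> W. R w z}" using xy R_sym True by auto
      then have "card {z \<in> ?W. R w z} < card {z \<in> W. R w z}"
        using finW by (intro psubset_card_mono) auto
      then show ?thesis using True by simp
    next
      case False
      then show ?thesis using finW by (auto intro!: card_mono)
    qed
    have "(\<Sum>w\<in>?W. card {z \<in> ?W. R w z}) + 1 = (\<Sum>w\<in>?W. card {z \<in> ?W. R w z} + (if w = y then 1 else 0))"
      using xy \<open>x \<noteq> y\<close> finW by (simp add: sum.distrib)
    also have "\<dots> \<le> (\<Sum>w\<in>?W. card {z \<in> W. R w z})"
      by (rule sum_mono) (rule le)
    finally have "(\<Sum>w\<in>?W. card {z \<in> ?W. R w z}) + 1 \<le> (\<Sum>w\<in>?W. card {z \<in> W. R w z})" .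
    moreover have "card {z \<in> W. R x z} \<ge> 1"
      using xy finW by (auto simp: Suc_le_eq card_gt_0_iff)
    moreover have "(\<Sum>w\<in>W. card {z \<in> W. R w z}) = card {z \<in> W. R x z} + (\<Sum>w\<in>?W. card {z \<in> W. R w z})"
      using finW xy(1) by (rule sum.remove)
    moreover have "card W = card ?W + 1"
      using finW xy(1) by (metis card.remove Suc_eq_plus1)
    ultimately have "(\<Sum>w\<in>?W. card {z \<in> ?W. R w z}) + 2 * k \<le> 2 * card ?W"
      using Suc.prems(2) by linarith
    then obtain A where "A \<subseteq> ?W" "card A = k" "\<forall>x\<in>A. \<forall>y\<in>A. \<not> R x y"
      using Suc.hyps(1)[of ?W] Suc.prems(1) Suc.hyps(2) \<open>card W = card ?W + 1\<close> by auto
    then show ?thesis by blast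
  qed
qed

lemma top_set_exists:
  assumes "j \<le> card V"
  shows "\<exists>T. top_set T \<and> card T = j"
  using assms
proof (induction j)
  case 0
  then show ?case by (intro exI[of _ "{}"]) (auto simp: top_set_def)
next
  case (Suc j)
  then obtain T where T: "top_set T" "card T = j" by auto
  have "T \<subseteq> V" using T by (simp add: top_set_def)
  then have "finite T" using finV by (rule finite_subset)
  have "V - T \<noteq> {}" using Suc.prems T(2) \<open>T \<subseteq> V\<close> by auto
  then have "Max (dg ` (V - T)) \<in> dg ` (V - T)"
    using finV by (intro Max_in) auto
  then obtain x where x: "x \<in> V - T" "dg x = Max (dg ` (V - T))" by auto
  then have "\<And>y. y \<in> V - T \<Longrightarrow> dg y \<le> dg x"
    using finV by simp
  then have "top_set (insert x T)"
    using T(1) x(1) by (auto simp: top_set_def)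
  then show ?case
    using x T(2) \<open>finite T\<close> by (intro exI[of _ "insert x T"]) auto
qed

end

section \<open>Sparse conflict relations\<close>

text \<open>The difference of the two sides is \<open>(d - e) * (N - d - e)\<close>.\<close>

lemma weight_mono:
  fixes d e N :: nat
  assumes "e \<le> d" "d + e \<le> N"
  shows "e * (N - e) \<le> d * (N - d)"
proof -
  obtain a where a: "d = e + a" using assms(1) le_Suc_ex by blast
  obtain b where b: "N = d + e + b" using assms(2) le_Suc_ex by blast
  have "e * (e + a + b) \<le> (e + a) * (e + b)" by (simp add: algebra_simps)
  then show ?thesis by (simp add: a b add.commute add.left_commute)
qed

text \<open>The bound \<open>weight_less\<close> is what the spectral hypothesis leaves of the complement \<open>R\<close>.\<close>

locale sparse_conflict = finite_conflict +
  fixes N :: nat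
  assumes cardV: "card V = Suc N" and N17: "17 \<le> N"
    and dg_le: "x \<in> V \<Longrightarrow> dg x + 4 \<le> N"
    and weight_less: "(\<Sum>x\<in>V. dg x * (N - dg x)) < N * N"
    and sum_dg_le: "(\<Sum>x\<in>V. dg x) \<le> 2 * (N - 1)"
begin

lemma weight_ge_1: "x \<in> V \<Longrightarrow> 1 \<le> dg x \<Longrightarrow> N - 1 \<le> dg x * (N - dg x)"
  using weight_mono[of 1 "dg x" N] dg_le[of x] by simp

lemma weight_sum_less:
  assumes "A \<subseteq> V"
  shows "(\<Sum>x\<in>A. dg x * (N - dg x)) < N * N"
  using sum_mono2[OF finV assms, of "\<lambda>x. dg x * (N - dg x)"] weight_less by simp

lemma weight_sum_disjoint_less:
  assumes "A \<subseteq> V" "B \<subseteq> V" "A \<inter> B = {}"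
    and "a \<le> (\<Sum>x\<in>A. dg x * (N - dg x))" "b \<le> (\<Sum>x\<in>B. dg x * (N - dg x))"
  shows "a + b < N * N"
proof -
  have "(\<Sum>x\<in>A \<union> B. dg x * (N - dg x)) = (\<Sum>x\<in>A. dg x * (N - dg x)) + (\<Sum>x\<in>B. dg x * (N - dg x))"
    using assms(1-3) finV by (intro sum.union_disjoint) (auto intro: finite_subset)
  then show ?thesis
    using weight_sum_less[of "A \<union> B"] assms by simp
qed

section \<open>Counting the isolated vertices\<close>

definition isolated :: "'a set" where "isolated = {x \<in> V. nb x = {}}"

text \<open>Each vertex of \<open>S\<close> weighs at least \<open>4 * (N - 4)\<close>, each further
  non-isolated vertex at least \<open>N - 1\<close>.\<close>

lemma isolated_bound:
  assumes "S \<subseteq> upper 4"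
  shows "card S * (4 * (N - 4)) + (N + 1 - card isolated - card S) * (N - 1) < N * N"
proof (rule weight_sum_disjoint_less[of S "V - isolated - S"])
  show "S \<subseteq> V" using assms by (auto simp: upper_def)
  have "4 * (N - 4) \<le> dg x * (N - dg x)" if "x \<in> S" for x
    using that assms dg_le by (intro weight_mono) (auto simp: upper_def)
  then show "card S * (4 * (N - 4)) \<le> (\<Sum>x\<in>S. dg x * (N - dg x))"
    using sum_bounded_below[of S "4 * (N - 4)" "\<lambda>x. dg x * (N - dg x)"] by simp
  have "N - 1 \<le> dg x * (N - dg x)" if "x \<in> V - isolated - S" for x
    using that by (intro weight_ge_1) (auto simp: isolated_def dg_def Suc_le_eq card_gt_0_iff)
  then have "card (V - isolated - S) * (N - 1) \<le> (\<Sum>x\<in>V - isolated - S. dg x * (N - dg x))"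
    using sum_bounded_below[of "V - isolated - S" "N - 1" "\<lambda>x. dg x * (N - dg x)"] by simp
  moreover have "N + 1 - card isolated - card S \<le> card (V - isolated - S)"
  proof -
    have "finite isolated" using finV by (simp add: isolated_def)
    moreover have "finite S" using \<open>S \<subseteq> V\<close> finV by (rule finite_subset)
    ultimately have "card V \<le> card (V - isolated - S) + card isolated + card S"
      using diff_card_le_card_Diff[of isolated V] diff_card_le_card_Diff[of S "V - isolated"] by linarith
    then show ?thesis using cardV by simp
  qed
  ultimately show "(N + 1 - card isolated - card S) * (N - 1) \<le> (\<Sum>x\<in>V - isolated - S. dg x * (N - dg x))"
    by (meson mult_le_mono1 order_trans)
qed auto

lemma card_isolated_ge:
  assumes "k \<le> card (upper 4)"
    and bad: "k * (4 * (N - 4)) + (N + 1 - i - k) * (N - 1) \<ge> N * N"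
  shows "i < card isolated"
proof (rule ccontr)
  assume "\<not> i < card isolated"
  then have i: "card isolated \<le> i" by simp
  obtain S where S: "S \<subseteq> upper 4" "card S = k" using assms(1) by (meson obtain_subset_with_card_n)
  have "(N + 1 - i - k) * (N - 1) \<le> (N + 1 - card isolated - k) * (N - 1)"
    using i by (intro mult_le_mono1) linarith
  then have "k * (4 * (N - 4)) + (N + 1 - i - k) * (N - 1) < N * N"
    using isolated_bound[OF S(1)] unfolding S(2) by linarith
  then show False using bad by linarith
qed

text \<open>The numbers 4, 7, 10 are \<open>3 * t - 2\<close> for \<open>t = 2, 3, 4\<close>, the
  sizes of the top sets to be combined with the isolated vertices.\<close>

lemma card_isolated_bounds:
  shows "2 \<le> card (upper 4) \<Longrightarrow> 4 \<le> card isolated"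
    and "3 \<le> card (upper 4) \<Longrightarrow> 7 \<le> card isolated"
    and "5 \<le> card (upper 4) \<Longrightarrow> 10 \<le> card isolated"
proof -
  obtain m where m: "N = 17 + m" using N17 le_Suc_ex by blast
  show "2 \<le> card (upper 4) \<Longrightarrow> 4 \<le> card isolated"
    using card_isolated_ge[of 2 3] by (simp add: m algebra_simps)
  show "3 \<le> card (upper 4) \<Longrightarrow> 7 \<le> card isolated"
    using card_isolated_ge[of 3 6] by (simp add: m algebra_simps)
  show "5 \<le> card (upper 4) \<Longrightarrow> 10 \<le> card isolated"
    using card_isolated_ge[of 5 9] by (simp add: m algebra_simps)
qed

section \<open>Bounds on the vertices of large degree\<close>

text \<open>A conflict leaving \<open>S\<close> is counted again in the degree of its outer end;
  conflicts inside \<open>S\<close> contribute at most \<open>card S - 1\<close> to each of its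
  vertices.\<close>

lemma sum_dg_outside:
  assumes "S \<subseteq> V"
  shows "(\<Sum>x\<in>S. dg x) \<le> (\<Sum>x\<in>V - S. dg x) + card S * (card S - 1)"
proof -
  have finS: "finite S" using assms finV by (rule finite_subset)
  have split: "dg x \<le> (\<Sum>y\<in>V - S. if R x y then 1 else 0) + (card S - 1)" if "x \<in> S" for x
  proof -
    have "nb x \<subseteq> {y \<in> V - S. R x y} \<union> (S - {x})"
      using R_irrefl by (auto simp: nb_def)
    then have "dg x \<le> card ({y \<in> V - S. R x y} \<union> (S - {x}))"
      unfolding dg_def using finV finS by (intro card_mono) auto
    also have "\<dots> \<le> card {y \<in> V - S. R x y} + card (S - {x})" by (rule card_Un_le)
    also have "card {y \<in> V - S. R x y} = (\<Sum>y\<in>V - S. if R x y then 1 else 0)"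
      using finV by (simp add: sum.If_cases Int_def)
    finally show ?thesis using that finS by simp
  qed
  have "(\<Sum>x\<in>S. dg x) \<le> (\<Sum>x\<in>S. (\<Sum>y\<in>V - S. if R x y then 1 else 0) + (card S - 1))"
    using split by (rule sum_mono)
  also have "\<dots> = (\<Sum>y\<in>V - S. \<Sum>x\<in>S. if R x y then 1 else 0) + card S * (card S - 1)"
    by (simp add: sum.distrib) (rule sum.swap)
  also have "(\<Sum>y\<in>V - S. \<Sum>x\<in>S. if R x y then 1 else 0) \<le> (\<Sum>y\<in>V - S. dg y)"
  proof (rule sum_mono)
    fix y
    have "(\<Sum>x\<in>S. if R x y then 1 else 0) = card {x \<in> S. R x y}"
      using finS by (simp add: sum.If_cases Int_def)
    also have "\<dots> \<le> dg y"
      unfolding dg_def using assms R_sym by (intro card_mono) (auto simp: nb_def finV)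
    finally show "(\<Sum>x\<in>S. if R x y then 1 else 0) \<le> dg y" .
  qed
  finally show ?thesis by simp
qed

lemma sum_four_dg:
  assumes "S \<subseteq> V" "card S = 4"
  shows "(\<Sum>x\<in>S. dg x) \<le> N + 5"
proof -
  have "(\<Sum>x\<in>V. dg x) = (\<Sum>x\<in>V - S. dg x) + (\<Sum>x\<in>S. dg x)"
    using assms(1) finV by (rule sum.subset_diff)
  then show ?thesis using sum_dg_outside[OF assms(1)] sum_dg_le assms(2) N17 by simp
qed

text \<open>Three other vertices of \<open>upper e\<close> take at least \<open>3 * e\<close> of the
  \<open>N + 5\<close> available to four vertices, and \<open>5 \<le> 2 * e\<close>. The bound
  serves as side condition of \<open>weight_mono\<close>.\<close>

lemma upper_dg_le:
  assumes "3 \<le> e" "4 \<le> card (upper e)" "x \<in> upper e"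
  shows "dg x + e \<le> N"
proof -
  have "3 \<le> card (upper e - {x})" using assms by simp
  then obtain S where S: "S \<subseteq> upper e - {x}" "card S = 3" by (meson obtain_subset_with_card_n)
  have finS: "finite S" using S(2) card.infinite by fastforce
  have "3 * e \<le> (\<Sum>y\<in>S. dg y)"
    using sum_bounded_below[of S e dg] S by (auto simp: upper_def)
  moreover have "x \<notin> S" "insert x S \<subseteq> V" using S(1) assms(3) by (auto simp: upper_def)
  moreover from this have "(\<Sum>y\<in>insert x S. dg y) \<le> N + 5"
    using S(2) finS by (intro sum_four_dg) auto
  moreover have "(\<Sum>y\<in>insert x S. dg y) = dg x + (\<Sum>y\<in>S. dg y)"
    using S finS by (intro sum.insert) auto
  ultimately show ?thesis using assms(1) by linarith
qed

lemma card_upper_weight: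
  assumes "\<And>x. x \<in> upper e \<Longrightarrow> dg x + e \<le> N"
  shows "card (upper e) * (e * (N - e)) < N * N"
proof -
  have "e * (N - e) \<le> dg x * (N - dg x)" if "x \<in> upper e" for x
    using that assms by (intro weight_mono) (auto simp: upper_def)
  then have "card (upper e) * (e * (N - e)) \<le> (\<Sum>x\<in>upper e. dg x * (N - dg x))"
    using sum_bounded_below[of "upper e" "e * (N - e)" "\<lambda>x. dg x * (N - dg x)"] by simp
  also have "\<dots> < N * N" by (rule weight_sum_less) (auto simp: upper_def)
  finally show ?thesis .
qed

lemma top_set_subset_upper:
  assumes "top_set T" "card T \<le> card (upper e)"
  shows "T \<subseteq> upper e"
proof (rule ccontr)
  assume "\<not> T \<subseteq> upper e"
  then obtain x where x: "x \<in> T" "dg x < e" using assms(1) by (force simp: top_set_def upper_def)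
  have "finite T" using assms(1) finV by (auto simp: top_set_def intro: finite_subset)
  have "upper e \<subseteq> T - {x}"
  proof
    fix y assume y: "y \<in> upper e"
    then have "dg x < dg y" using x(2) by (simp add: upper_def)
    then show "y \<in> T - {x}"
      using assms(1) x(1) y by (auto simp: top_set_def upper_def not_le[symmetric])
  qed
  then have "card (upper e) \<le> card (T - {x})" using \<open>finite T\<close> by (intro card_mono) auto
  also have "\<dots> < card T" using \<open>finite T\<close> x(1) by (rule card_Diff1_less)
  finally show False using assms(2) by simp
qed

text \<open>Four vertices of degree at least \<open>f\<close> send at least \<open>4 f - 12\<close> edges to the outside, where the
  degrees are at most \<open>f\<close>; hence \<open>(8 f - 12) (N - f) < N\<^sup>2\<close>.\<close>

lemma four_times_less:
  assumes "4 \<le> card (upper e)"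
  shows "4 * e < N"
proof (cases "e \<le> 4")
  case True
  then show ?thesis using N17 by simp
next
  case False
  obtain S where S: "top_set S" "card S = 4"
    using top_set_exists[of 4] cardV N17 by auto
  have SV: "S \<subseteq> V" using S(1) by (simp add: top_set_def)
  have finS: "finite S" using SV finV by (rule finite_subset)
  have Se: "S \<subseteq> upper e" using S assms by (intro top_set_subset_upper) auto
  \<comment> \<open>The least degree among four top vertices; all vertices outside \<open>S\<close>
    have degree at most \<open>f\<close>.\<close>
  define f where "f = Min (dg ` S)"
  have "f \<in> dg ` S" unfolding f_def using finS S(2) by (intro Min_in) auto
  then obtain s where s: "s \<in> S" "dg s = f" by auto
  have f_le: "f \<le> dg x" if "x \<in> S" for x
    unfolding f_def using finS that by simp
  have "e \<le> f" using s Se by (auto simp: upper_def)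
  then have f5: "5 \<le> f" using False by simp
  have Sf: "S \<subseteq> upper f" using f_le SV by (auto simp: upper_def)
  then have "4 \<le> card (upper f)" using S(2) card_mono[OF finite_upper] by metis
  then have dgf: "dg x + f \<le> N" if "x \<in> S" for x
    using that Sf f5 by (intro upper_dg_le) auto
  have f4: "4 * f \<le> (\<Sum>x\<in>S. dg x)"
    using sum_bounded_below[of S f dg] f_le S(2) by simp
  then have fN: "4 * f \<le> N + 5" using sum_four_dg[OF SV S(2)] by linarith
  have out: "4 * f - 12 \<le> (\<Sum>x\<in>V - S. dg x)"
    using sum_dg_outside[OF SV] f4 S(2) by simp
  have "4 * (f * (N - f)) + (4 * f - 12) * (N - f) < N * N"
  proof (rule weight_sum_disjoint_less[OF SV, of "V - S"])
    have "f * (N - f) \<le> dg x * (N - dg x)" if "x \<in> S" for x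
      using that dgf f_le by (intro weight_mono) auto
    then show "4 * (f * (N - f)) \<le> (\<Sum>x\<in>S. dg x * (N - dg x))"
      using sum_bounded_below[of S "f * (N - f)" "\<lambda>x. dg x * (N - dg x)"] S(2) by simp
    have "(4 * f - 12) * (N - f) \<le> (\<Sum>x\<in>V - S. dg x) * (N - f)"
      using out by (rule mult_le_mono1)
    also have "\<dots> = (\<Sum>x\<in>V - S. dg x * (N - f))" by (rule sum_distrib_right)
    also have "\<dots> \<le> (\<Sum>x\<in>V - S. dg x * (N - dg x))"
      using S(1) s by (intro sum_mono mult_le_mono2) (auto simp: top_set_def intro!: diff_le_mono2)
    finally show "(4 * f - 12) * (N - f) \<le> (\<Sum>x\<in>V - S. dg x * (N - dg x))" .
  qed auto
  then have "int (4 * (f * (N - f)) + (4 * f - 12) * (N - f)) < int (N * N)"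
    by (simp only: of_nat_less_iff)
  moreover have "f \<le> N" using dgf[OF s(1)] by simp
  ultimately have less: "4 * (int f * (int N - int f)) + (4 * int f - 12) * (int N - int f) < int N * int N"
    using f5 by (simp add: of_nat_diff)
  have "4 * f < N"
  proof (rule ccontr)
    assume "\<not> 4 * f < N"
    \<comment> \<open>The excess of \<open>4 * f\<close> over \<open>N\<close> lies between 0 and 5.
      Substituting \<open>N = 4 * f - u\<close> turns the inequality into
      \<open>8 * f * f - 36 * f + u * (12 - u) < 0\<close>, which fails for
      \<open>f \<ge> 5\<close>.\<close>
    define u where "u = 4 * int f - int N"
    have u: "0 \<le> u" "u \<le> 5" "int N = 4 * int f - u"
      using \<open>\<not> 4 * f < N\<close> fN by (auto simp: u_def)
    have "0 \<le> u * (12 - u)" using u by simp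
    moreover have "5 * int f \<le> int f * int f" using f5 by (intro mult_right_mono) auto
    moreover have "8 * (int f * int f) - 36 * int f + u * (12 - u) < 0"
      using less unfolding u(3) by (simp add: algebra_simps)
    ultimately show False using f5 by linarith
  qed
  then show ?thesis using \<open>e \<le> f\<close> by simp
qed

text \<open>Otherwise the weight would be at least \<open>3 * (N - 10) * (N - 3)\<close>, which is
  no less than \<open>N * N\<close> from \<open>N = 17\<close> on, where it is 294 against
  289.\<close>

lemma card_upper_3: "card (upper 3) + 11 \<le> N"
proof (rule ccontr)
  assume bad: "\<not> ?thesis"
  obtain m where m: "N = 17 + m" using N17 le_Suc_ex by blast
  have "(7 + m) * (3 * (N - 3)) \<le> card (upper 3) * (3 * (N - 3))"
    using bad m by (intro mult_le_mono1) simp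
  moreover have "card (upper 3) * (3 * (N - 3)) < N * N"
    using dg_le by (intro card_upper_weight) (force simp: upper_def)
  ultimately show False by (simp add: m algebra_simps)
qed

lemma card_upper_2: "card (upper 2) + 7 \<le> N"
proof (rule ccontr)
  assume bad: "\<not> ?thesis"
  obtain m where m: "N = 17 + m" using N17 le_Suc_ex by blast
  have "(11 + m) * (2 * (N - 2)) \<le> card (upper 2) * (2 * (N - 2))"
    using bad m by (intro mult_le_mono1) simp
  moreover have "card (upper 2) * (2 * (N - 2)) < N * N"
    using dg_le by (intro card_upper_weight) (force simp: upper_def)
  ultimately show False by (simp add: m algebra_simps)
qed

text \<open>With \<open>N = 4 * e + p\<close>, failure would give
  \<open>(p + 5) * e * (3 * e + p) < (4 * e + p) * (4 * e + p)\<close>. This is impossible for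
  \<open>e \<ge> 2\<close> and \<open>p \<ge> 1\<close>, the latter being
  \<open>four_times_less\<close>.\<close>

lemma card_upper_five:
  assumes "2 \<le> e" "5 \<le> card (upper e)"
  shows "card (upper e) + 4 * e \<le> N + 4"
proof (rule ccontr)
  assume bad: "\<not> ?thesis"
  have "4 * e < N" using assms(2) by (intro four_times_less) simp
  then obtain p where p: "N = 4 * e + p" "1 \<le> p"
    using less_imp_add_positive[of "4 * e" N] by auto
  have "dg x + e \<le> N" if "x \<in> upper e" for x
  proof (cases "3 \<le> e")
    case True
    then show ?thesis using assms(2) that by (intro upper_dg_le) auto
  next
    case False
    then show ?thesis using dg_le[of x] that by (auto simp: upper_def)
  qed
  then have "card (upper e) * (e * (N - e)) < N * N" by (rule card_upper_weight)
  moreover have "(p + 5) * (e * (N - e)) \<le> card (upper e) * (e * (N - e))"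
    using bad p by (intro mult_le_mono1) simp
  ultimately have "(p + 5) * (e * (N - e)) < N * N" by linarith
  then have "(p + 5) * (e * (3 * e + p)) < (4 * e + p) * (4 * e + p)"
    using p by simp
  moreover obtain q where q: "p = Suc q" using p(2) by (cases p) auto
  moreover obtain g where g: "e = 2 + g" using assms(1) le_Suc_ex by blast
  ultimately show False by (simp add: algebra_simps)
qed

end

section \<open>Square cycles in sparse conflict graphs\<close>

context sparse_conflict begin

lemma square_cyclic_top_isolated:
  assumes T: "top_set T" "T \<subseteq> upper 4" "2 \<le> card T"
    and iso: "4 \<le> card isolated" "3 * card T \<le> card isolated + 2"
    and few: "\<And>x. x \<in> V - T \<Longrightarrow> 2 \<le> dg x \<Longrightarrow> card (upper (dg x)) + 4 * dg x \<le> N + card T"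
  shows "square_cyclic R V"
proof (rule square_cyclic_grow_top)
  have TV: "T \<subseteq> V" using T(1) by (simp add: top_set_def)
  have disj: "isolated \<inter> T = {}"
    using T(2) by (auto simp: isolated_def upper_def dg_def)
  show "square_cyclic R (isolated \<union> T)"
    using iso TV disj by (intro square_cyclic_isolated_Un) (auto simp: isolated_def)
  show "isolated \<union> T \<subseteq> V" using TV by (auto simp: isolated_def)
  have "card (isolated \<union> T) = card isolated + card T"
    using disj TV finV by (intro card_Un_disjoint) (auto simp: isolated_def intro: finite_subset)
  then show "5 \<le> card (isolated \<union> T)" using iso T(3) by simp
  show "card (upper (dg x)) + 4 * dg x < card V + card T"
    if "x \<in> V - (isolated \<union> T)" "2 \<le> dg x" for x
    using few[of x] that cardV by simp
qed (use T in auto)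

lemma insert_subset_upper:
  assumes "top_set T" "x \<in> V - T"
  shows "insert x T \<subseteq> upper (dg x)"
  using assms by (auto simp: top_set_def upper_def)

lemma card_less_card_upper:
  assumes "top_set T" "x \<in> V - T"
  shows "card T < card (upper (dg x))"
proof -
  have "finite T" using assms(1) finV by (auto simp: top_set_def intro: finite_subset)
  then have "card (insert x T) = Suc (card T)" using assms(2) by simp
  then show ?thesis
    using card_mono[OF finite_upper insert_subset_upper[OF assms]] by simp
qed

lemma upper_mono: "d \<le> e \<Longrightarrow> card (upper e) \<le> card (upper d)"
  by (rule card_mono) (auto simp: upper_def finV)

lemma few_small:
  assumes "2 \<le> e" "e \<le> 3"
  shows "card (upper e) + 4 * e \<le> N + 1"
proof -
  have "e = 2 \<or> e = 3" using assms by linarith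
  then show ?thesis using card_upper_2 card_upper_3 by auto
qed

text \<open>The top set has size 2, 3 or 4 according to the number of vertices of degree at least 4.
  Each size is small enough for the isolated vertices at hand and leaves over only vertices that a
  counting bound covers.\<close>

lemma square_cyclic_many_upper:
  assumes "2 \<le> card (upper 4)"
  shows "square_cyclic R V"
proof -
  consider "card (upper 4) = 2" | "3 \<le> card (upper 4)" "card (upper 4) \<le> 4" | "5 \<le> card (upper 4)"
    using assms by linarith
  then show ?thesis
  proof cases
    case 1
    obtain T where T: "top_set T" "card T = 2"
      using top_set_exists[of 2] cardV N17 by auto
    show ?thesis
    proof (rule square_cyclic_top_isolated[OF T(1)])
      fix x assume x: "x \<in> V - T" "2 \<le> dg x"
      have "dg x \<le> 3"
      proof (rule ccontr)
        assume "\<not> dg x \<le> 3"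
        then have "card (upper (dg x)) \<le> 2" using upper_mono[of 4 "dg x"] 1 by simp
        then show False using card_less_card_upper[OF T(1) x(1)] T(2) by simp
      qed
      then show "card (upper (dg x)) + 4 * dg x \<le> N + card T"
        using few_small[of "dg x"] x T(2) by simp
    qed (use T 1 card_isolated_bounds top_set_subset_upper in auto)
  next
    case 2
    obtain T where T: "top_set T" "card T = 3"
      using top_set_exists[of 3] cardV N17 by auto
    show ?thesis
    proof (rule square_cyclic_top_isolated[OF T(1)])
      fix x assume x: "x \<in> V - T" "2 \<le> dg x"
      show "card (upper (dg x)) + 4 * dg x \<le> N + card T"
      proof (cases "dg x \<le> 3")
        case True
        then show ?thesis using few_small[of "dg x"] x T(2) by simp
      next
        case False
        then have "card (upper (dg x)) \<le> 4" using upper_mono[of 4 "dg x"] 2 by simp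
        \<comment> \<open>Besides the three members of \<open>T\<close>, \<open>x\<close> is a
          fourth vertex of degree at least \<open>dg x\<close>.\<close>
        moreover have "4 * dg x < N"
          using card_less_card_upper[OF T(1) x(1)] T(2) by (intro four_times_less) simp
        ultimately show ?thesis using T(2) by simp
      qed
    qed (use T 2 card_isolated_bounds top_set_subset_upper in auto)
  next
    case 3
    obtain T where T: "top_set T" "card T = 4"
      using top_set_exists[of 4] cardV N17 by auto
    show ?thesis
    proof (rule square_cyclic_top_isolated[OF T(1)])
      fix x assume x: "x \<in> V - T" "2 \<le> dg x"
      then show "card (upper (dg x)) + 4 * dg x \<le> N + card T"
        using card_less_card_upper[OF T(1) x(1)] T(2) card_upper_five[of "dg x"] by simp
    qed (use T 3 card_isolated_bounds top_set_subset_upper in auto)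
  qed
qed

text \<open>Start from a vertex \<open>v\<close> of maximal degree together with four independent vertices that are not
  in conflict with it.\<close>

lemma square_cyclic_few_upper:
  assumes "card (upper 4) \<le> 1"
  shows "square_cyclic R V"
proof -
  obtain T where T: "top_set T" "card T = 1"
    using top_set_exists[of 1] cardV by auto
  then obtain v where v: "T = {v}" by (auto simp: card_1_singleton_iff)
  have vV: "v \<in> V" using T v by (simp add: top_set_def)
  have small: "dg x \<le> 3" if "x \<in> V" "x \<noteq> v" for x
  proof (rule ccontr)
    assume "\<not> dg x \<le> 3"
    then have "card (upper (dg x)) \<le> 1" using upper_mono[of 4 "dg x"] assms by simp
    then show False using card_less_card_upper[OF T(1), of x] that v by simp
  qed
  define W where "W = V - {v} - nb v"
  have WV: "W \<subseteq> V" by (auto simp: W_def)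
  have finW: "finite W" using WV finV by (rule finite_subset)
  define D where "D = card W"
  have nbV: "nb v \<subseteq> V - {v}" using R_irrefl by (auto simp: nb_def)
  have "card W = card (V - {v}) - card (nb v)"
    unfolding W_def using nbV by (intro card_Diff_subset) auto
  then have DN: "dg v + D = N"
    using cardV vV dg_le[OF vV] finV by (simp add: D_def dg_def)
  have "N - dg v = D" using DN by simp
  have D4: "4 \<le> D" using DN dg_le[OF vV] by simp
  define a where "a = (\<Sum>x\<in>W. card {y \<in> W. R x y})"
  \<comment> \<open>The count that yields four independent vertices of \<open>W\<close>. Were it to
    fail, the weight, split over \<open>v\<close>, \<open>W\<close> and \<open>nb v\<close>, would
    reach \<open>N * N\<close>.\<close>
  have "a + 2 * 4 \<le> 2 * card W"
  proof (rule ccontr)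
    assume bad: "\<not> ?thesis"
    have "(\<Sum>x\<in>V. dg x * (N - dg x)) = dg v * (N - dg v) + (\<Sum>x\<in>V - {v}. dg x * (N - dg x))"
      using finV vV by (rule sum.remove)
    also have "(\<Sum>x\<in>V - {v}. dg x * (N - dg x)) = (\<Sum>x\<in>W. dg x * (N - dg x)) + (\<Sum>x\<in>nb v. dg x * (N - dg x))"
      unfolding W_def using nbV finV by (intro sum.subset_diff) auto
    finally have split: "dg v * D + (\<Sum>x\<in>W. dg x * (N - dg x)) + (\<Sum>x\<in>nb v. dg x * (N - dg x)) < N * N"
      using weight_less \<open>N - dg v = D\<close> by simp
    have "N - 1 \<le> dg x * (N - dg x)" if "x \<in> nb v" for x
    proof -
      have "v \<in> nb x" using that vV R_sym by (auto simp: nb_def)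
      then have "1 \<le> dg x" by (auto simp: dg_def Suc_le_eq card_gt_0_iff)
      then show ?thesis using that by (intro weight_ge_1) (auto simp: nb_def)
    qed
    then have nbw: "dg v * (N - 1) \<le> (\<Sum>x\<in>nb v. dg x * (N - dg x))"
      using sum_bounded_below[of "nb v" "N - 1" "\<lambda>x. dg x * (N - dg x)"] by (simp add: dg_def)
    have dgv: "int (dg v) = int N - int D" using DN by simp
    have N1: "int (N - 1) = int N - 1" "int (N - 3) = int N - 3" using N17 by auto
    show False
    proof (cases "D = 4")
      \<comment> \<open>The estimate \<open>a \<ge> 2 * D - 7\<close> of the other case would only
        give 1 here. Instead both ends of a conflict inside \<open>W\<close> are counted, each
        weighing at least \<open>N - 1\<close>.\<close>
      case True
      have "a \<noteq> 0" using bad True D_def by simp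
      then obtain x where x: "x \<in> W" "card {y \<in> W. R x y} \<noteq> 0"
        unfolding a_def using finW by auto
      then obtain y where y: "y \<in> W" "R x y" by (metis (mono_tags, lifting) card.empty empty_Collect_eq)
      have "x \<noteq> y" using y R_irrefl by blast
      have "x \<in> nb y" "y \<in> nb x" using x y WV R_sym by (auto simp: nb_def)
      then have "1 \<le> dg x" "1 \<le> dg y" by (auto simp: dg_def Suc_le_eq card_gt_0_iff)
      then have "N - 1 \<le> dg z * (N - dg z)" if "z \<in> {x, y}" for z
        using that x y WV by (intro weight_ge_1) auto
      then have "card {x, y} * (N - 1) \<le> (\<Sum>x\<in>{x, y}. dg x * (N - dg x))"
        using sum_bounded_below[of "{x, y}" "N - 1" "\<lambda>x. dg x * (N - dg x)"] by simp
      also have "\<dots> \<le> (\<Sum>x\<in>W. dg x * (N - dg x))"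
        using finW x y by (intro sum_mono2) auto
      finally have "2 * (N - 1) \<le> (\<Sum>x\<in>W. dg x * (N - dg x))" using \<open>x \<noteq> y\<close> by simp
      then have "dg v * 4 + 2 * (N - 1) + dg v * (N - 1) < N * N"
        using split nbw unfolding True by linarith
      moreover obtain m where "N = 17 + m" using N17 le_Suc_ex by blast
      moreover have "dg v = N - 4" using DN True by simp
      ultimately show False by (simp add: algebra_simps)
    next
      case False
      then have D5: "5 \<le> D" using D4 by simp
      have "card {y \<in> W. R x y} * (N - 3) \<le> dg x * (N - dg x)" if "x \<in> W" for x
      proof (rule mult_le_mono)
        show "card {y \<in> W. R x y} \<le> dg x"
          unfolding dg_def using WV by (intro card_mono) (auto simp: nb_def finV)
        show "N - 3 \<le> N - dg x"
          using small[of x] that by (intro diff_le_mono2) (auto simp: W_def)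
      qed
      then have "a * (N - 3) \<le> (\<Sum>x\<in>W. dg x * (N - dg x))"
        unfolding a_def sum_distrib_right by (rule sum_mono)
      moreover have "(2 * D - 7) * (N - 3) \<le> a * (N - 3)"
        using bad D_def by (intro mult_le_mono1) simp
      ultimately have "dg v * D + (2 * D - 7) * (N - 3) + dg v * (N - 1) < N * N"
        using split nbw by linarith
      then have "int (dg v * D + (2 * D - 7) * (N - 3) + dg v * (N - 1)) < int (N * N)"
        by (simp only: of_nat_less_iff)
      then have "(int N - int D) * int D + (2 * int D - 7) * (int N - 3) + (int N - int D) * (int N - 1) < int N * int N"
        using D5 N1 dgv by (simp add: of_nat_diff)
      then have *: "int N * (2 * int D - 8) < int D * int D + 5 * int D - 21"
        by (simp add: algebra_simps)
      show False
      \<comment> \<open>Up to 24 the bound \<open>N \<ge> 17\<close> suffices, since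
        \<open>17 * (2 * D - 8)\<close> exceeds the right-hand side by
        \<open>(D - 5) * (24 - D) + 5\<close>; beyond that \<open>N \<ge> D\<close> does.\<close>
      proof (cases "D \<le> 24")
        case True
        have "17 * (2 * int D - 8) \<le> int N * (2 * int D - 8)"
          using N17 D4 by (intro mult_right_mono) auto
        moreover have "0 \<le> (int D - 5) * (24 - int D)" using D5 True by simp
        ultimately show False using * by (simp add: algebra_simps)
      next
        case False
        have "int D * (2 * int D - 8) \<le> int N * (2 * int D - 8)"
          using DN D4 by (intro mult_right_mono) auto
        then have "2 * (int D * int D) - 8 * int D < int D * int D + 5 * int D - 21"
          using * by (simp add: algebra_simps)
        moreover have "25 * int D \<le> int D * int D" using False by (intro mult_right_mono) auto
        ultimately show False using False by linarith
      qed
    qed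
  qed
  then obtain A where A: "A \<subseteq> W" "card A = 4" "\<forall>x\<in>A. \<forall>y\<in>A. \<not> R x y"
    using independent_subset_exists[OF WV, of 4] unfolding a_def by blast
  have finA: "finite A" using A(1) finW by (rule finite_subset)
  have vA: "\<not> R v x" "\<not> R x v" if "x \<in> A" for x
    using that A(1) R_sym by (auto simp: W_def nb_def)
  show ?thesis
  proof (rule square_cyclic_grow_top[of "insert v A" T])
    show "square_cyclic R (insert v A)"
      using finA A(3) vA R_irrefl by (intro square_cyclic_independent) auto
    show "insert v A \<subseteq> V" using A(1) WV vV by auto
    have "v \<notin> A" using A(1) by (auto simp: W_def)
    then show "5 \<le> card (insert v A)" using finA A(2) by simp
    fix x assume x: "x \<in> V - insert v A" "2 \<le> dg x"
    then show "card (upper (dg x)) + 4 * dg x < card V + card T"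
      using few_small[of "dg x"] small[of x] cardV T(2) by simp
  qed (use T v in auto)
qed

lemma square_cyclic_V: "square_cyclic R V"
  using square_cyclic_many_upper square_cyclic_few_upper by (cases "2 \<le> card (upper 4)") auto

end

section \<open>Eigenvalues and supersolutions\<close>

text \<open>The set \<open>Z\<close> consists of the maximisers of \<open>\<bar>x i\<bar> / z i\<close>.\<close>

lemma perron_closed_set:
  fixes x z :: "'a \<Rightarrow> real"
  assumes fin: "finite V" and nbV: "\<And>i. i \<in> V \<Longrightarrow> E i \<subseteq> V"
    and z: "\<And>i. i \<in> V \<Longrightarrow> 0 < z i"
    and super: "\<And>i. i \<in> V \<Longrightarrow> (\<Sum>j\<in>E i. z j) \<le> c * z i"
    and eig: "\<And>i. i \<in> V \<Longrightarrow> (\<Sum>j\<in>E i. x j) = \<mu> * x i"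
    and nz: "\<exists>i\<in>V. x i \<noteq> 0"
    and c: "0 \<le> c" "c \<le> \<mu>"
  shows "\<mu> = c" and "\<exists>Z\<subseteq>V. Z \<noteq> {} \<and> (\<forall>i\<in>Z. E i \<subseteq> Z \<and> (\<Sum>j\<in>E i. z j) = c * z i)"
proof -
  have finE: "finite (E i)" if "i \<in> V" for i
    using nbV[OF that] fin by (rule finite_subset)
  define M where "M = Max ((\<lambda>i. \<bar>x i\<bar> / z i) ` V)"
  define Z where "Z = {i \<in> V. \<bar>x i\<bar> = M * z i}"
  have ne: "V \<noteq> {}" using nz by blast
  have le: "\<bar>x i\<bar> \<le> M * z i" if "i \<in> V" for i
  proof -
    have "\<bar>x i\<bar> / z i \<le> M" unfolding M_def using fin that by simp
    then show ?thesis using z[OF that] by (simp add: pos_divide_le_eq)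
  qed
  have "M \<in> (\<lambda>i. \<bar>x i\<bar> / z i) ` V" unfolding M_def using fin ne by (intro Max_in) auto
  then obtain k where k: "k \<in> V" "M = \<bar>x k\<bar> / z k" by blast
  then have kZ: "k \<in> Z" using z[OF k(1)] by (simp add: Z_def)
  obtain i0 where i0: "i0 \<in> V" "x i0 \<noteq> 0" using nz by blast
  have Mpos: "0 < M"
  proof -
    have "0 < M * z i0" using le[OF i0(1)] i0(2) by linarith
    then show ?thesis using z[OF i0(1)] by (simp add: zero_less_mult_iff)
  qed
  \<comment> \<open>At a maximiser, \<open>\<mu> * (M * z i)\<close> is at most the sum of the
    \<open>\<bar>x j\<bar>\<close>, this at most \<open>M\<close> times the sum of the
    \<open>z j\<close>, this at most \<open>c * (M * z i)\<close>, and this at most the first term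
    again; so all agree.\<close>
  have key: "\<mu> = c \<and> (\<Sum>j\<in>E i. z j) = c * z i \<and> (\<Sum>j\<in>E i. \<bar>x j\<bar>) = (\<Sum>j\<in>E i. M * z j)" if "i \<in> Z" for i
  proof -
    have iV: "i \<in> V" and xi: "\<bar>x i\<bar> = M * z i" using that by (auto simp: Z_def)
    have zi: "0 < M * z i" using Mpos z[OF iV] by simp
    have "\<mu> * (M * z i) = \<bar>\<Sum>j\<in>E i. x j\<bar>" using eig[OF iV] c xi by (simp add: abs_mult)
    also have "\<dots> \<le> (\<Sum>j\<in>E i. \<bar>x j\<bar>)" by (rule sum_abs)
    finally have 1: "\<mu> * (M * z i) \<le> (\<Sum>j\<in>E i. \<bar>x j\<bar>)" .
    have 2: "(\<Sum>j\<in>E i. \<bar>x j\<bar>) \<le> (\<Sum>j\<in>E i. M * z j)"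
      using nbV[OF iV] le by (intro sum_mono) auto
    have 3: "(\<Sum>j\<in>E i. M * z j) = M * (\<Sum>j\<in>E i. z j)" by (rule sum_distrib_left[symmetric])
    have 4: "M * (\<Sum>j\<in>E i. z j) \<le> M * (c * z i)"
      using super[OF iV] Mpos by (intro mult_left_mono) auto
    have 5: "c * (M * z i) \<le> \<mu> * (M * z i)" using c zi by (intro mult_right_mono) auto
    have 6: "M * (c * z i) = c * (M * z i)" by simp
    have "\<mu> * (M * z i) = c * (M * z i)" using 1 2 3 4 5 6 by linarith
    moreover have "M * (\<Sum>j\<in>E i. z j) = M * (c * z i)" using 1 2 3 4 5 6 by linarith
    moreover have "(\<Sum>j\<in>E i. \<bar>x j\<bar>) = (\<Sum>j\<in>E i. M * z j)" using 1 2 3 4 5 6 by linarith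
    ultimately show ?thesis using zi Mpos by auto
  qed
  show "\<mu> = c" using key[OF kZ] by blast
  have "E i \<subseteq> Z" if "i \<in> Z" for i
  proof
    fix j assume j: "j \<in> E i"
    have iV: "i \<in> V" using that by (simp add: Z_def)
    \<comment> \<open>Equal sums of termwise ordered summands agree termwise, so the neighbours of a
      maximiser are maximisers.\<close>
    have "(\<Sum>j\<in>E i. M * z j - \<bar>x j\<bar>) = 0"
      using key[OF that] by (simp add: sum_subtractf)
    moreover have "0 \<le> M * z j - \<bar>x j\<bar>" if "j \<in> E i" for j
      using le[of j] nbV[OF iV] that by auto
    ultimately have "M * z j - \<bar>x j\<bar> = 0"
      using j finE[OF iV] by (simp add: sum_nonneg_eq_0_iff)
    then show "j \<in> Z" using j nbV[OF iV] by (auto simp: Z_def)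
  qed
  then show "\<exists>Z\<subseteq>V. Z \<noteq> {} \<and> (\<forall>i\<in>Z. E i \<subseteq> Z \<and> (\<Sum>j\<in>E i. z j) = c * z i)"
    using key kZ by (intro exI[of _ Z]) (auto simp: Z_def)
qed

section \<open>Existence of the largest adjacency eigenvalue\<close>

text \<open>Eigenvectors become plain functions, free of dimensions; the field is arbitrary because
  both complex and real matrices occur.\<close>

lemma eigenvalue_iff_sum:
  fixes A :: "'b :: field mat"
  assumes A: "A \<in> carrier_mat n n"
  shows "eigenvalue A c \<longleftrightarrow>
    (\<exists>x. (\<exists>i<n. x i \<noteq> 0) \<and> (\<forall>i<n. (\<Sum>j<n. A $$ (i, j) * x j) = c * x i))"
proof
  assume "eigenvalue A c"
  then obtain v where v: "v \<in> carrier_vec n" "v \<noteq> 0\<^sub>v n" "A *\<^sub>v v = c \<cdot>\<^sub>v v"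
    using A unfolding eigenvalue_def eigenvector_def by auto
  have "(\<Sum>j<n. A $$ (i, j) * v $ j) = c * v $ i" if "i < n" for i
    using arg_cong[OF v(3), of "\<lambda>w. w $ i"] that v(1) A
    by (simp add: scalar_prod_def atLeast0LessThan)
  moreover have "\<exists>i<n. v $ i \<noteq> 0"
    using v(1,2) by (metis eq_vecI carrier_vecD index_zero_vec)
  ultimately show "\<exists>x. (\<exists>i<n. x i \<noteq> 0) \<and> (\<forall>i<n. (\<Sum>j<n. A $$ (i, j) * x j) = c * x i)"
    by (intro exI[of _ "\<lambda>i. v $ i"]) auto
next
  assume "\<exists>x. (\<exists>i<n. x i \<noteq> 0) \<and> (\<forall>i<n. (\<Sum>j<n. A $$ (i, j) * x j) = c * x i)"
  then obtain x k where k: "k < n" "x k \<noteq> 0"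
    and x: "\<And>i. i < n \<Longrightarrow> (\<Sum>j<n. A $$ (i, j) * x j) = c * x i" by blast
  have "A *\<^sub>v vec n x = c \<cdot>\<^sub>v vec n x"
    using A x by (intro eq_vecI) (auto simp: scalar_prod_def atLeast0LessThan)
  moreover have "vec n x \<noteq> 0\<^sub>v n" using k by (metis index_vec index_zero_vec(1))
  ultimately show "eigenvalue A c"
    using A unfolding eigenvalue_def eigenvector_def by (intro exI[of _ "vec n x"]) auto
qed

text \<open>A complex eigenvalue \<open>c\<close> exists. The Hermitian form at its eigenvector
  equals \<open>c\<close> times the squared norm and is its own conjugate, so \<open>c\<close> is
  real, and the real or the imaginary part of the eigenvector is a real eigenvector.\<close>

lemma symmetric_real_eigenvalue_exists:
  fixes A :: "real mat"
  assumes A: "A \<in> carrier_mat n n" and n: "0 < n"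
    and sym: "\<And>i j. i < n \<Longrightarrow> j < n \<Longrightarrow> A $$ (i, j) = A $$ (j, i)"
  shows "\<exists>c. eigenvalue A c"
proof -
  define B where "B = map_mat complex_of_real A"
  have B: "B \<in> carrier_mat n n" using A by (simp add: B_def)
  have Bij: "B $$ (i, j) = complex_of_real (A $$ (i, j))" if "i < n" "j < n" for i j
    using A that by (simp add: B_def)
  obtain c where "eigenvalue B c"
    using spectrum_non_empty[OF B n] by (auto simp: spectrum_def)
  then obtain v k where k: "k < n" "v k \<noteq> 0"
    and v: "\<And>i. i < n \<Longrightarrow> (\<Sum>j<n. B $$ (i, j) * v j) = c * v i"
    unfolding eigenvalue_iff_sum[OF B] by blast
  have row: "(\<Sum>j<n. complex_of_real (A $$ (i, j)) * v j) = c * v i" if "i < n" for i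
    using v[OF that] Bij[OF that] by simp
  define Q where "Q = (\<Sum>i<n. \<Sum>j<n. cnj (v i) * (complex_of_real (A $$ (i, j)) * v j))"
  define S where "S = (\<Sum>i<n. (cmod (v i))\<^sup>2)"
  have "Q = (\<Sum>i<n. cnj (v i) * (c * v i))"
    unfolding Q_def by (simp add: sum_distrib_left[symmetric] row)
  also have "\<dots> = (\<Sum>i<n. c * (v i * cnj (v i)))"
    by (intro sum.cong refl) (simp only: mult_ac)
  also have "\<dots> = (\<Sum>i<n. c * complex_of_real ((cmod (v i))\<^sup>2))"
    by (simp only: complex_norm_square)
  also have "\<dots> = c * complex_of_real S"
    by (simp add: S_def sum_distrib_left)
  finally have Q: "Q = c * complex_of_real S" .
  have "cnj Q = (\<Sum>i<n. \<Sum>j<n. v i * (complex_of_real (A $$ (i, j)) * cnj (v j)))"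
    by (simp add: Q_def)
  also have "\<dots> = (\<Sum>j<n. \<Sum>i<n. v i * (complex_of_real (A $$ (i, j)) * cnj (v j)))"
    by (rule sum.swap)
  also have "\<dots> = Q"
    unfolding Q_def using sym by (intro sum.cong refl) (simp add: mult_ac)
  finally have cnjQ: "cnj Q = Q" .
  have "0 < S"
  proof -
    have "0 < (cmod (v k))\<^sup>2" using k by simp
    also have "\<dots> \<le> S" unfolding S_def using k by (intro member_le_sum) auto
    finally show ?thesis .
  qed
  then have "cnj c = c" using Q cnjQ by simp
  then obtain r where r: "c = complex_of_real r"
    by (metis Reals_cases Reals_cnj_iff)
  have re: "(\<Sum>j<n. A $$ (i, j) * Re (v j)) = r * Re (v i)"
    and im: "(\<Sum>j<n. A $$ (i, j) * Im (v j)) = r * Im (v i)" if "i < n" for i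
    using arg_cong[OF row[OF that], of Re] arg_cong[OF row[OF that], of Im] by (simp_all add: r)
  have "Re (v k) \<noteq> 0 \<or> Im (v k) \<noteq> 0"
    using k(2) complex_eqI[of "v k" 0] by auto
  then have "eigenvalue A r"
  proof
    assume "Re (v k) \<noteq> 0"
    then show ?thesis
      unfolding eigenvalue_iff_sum[OF A] using re k(1) by (intro exI[of _ "\<lambda>j. Re (v j)"]) auto
  next
    assume "Im (v k) \<noteq> 0"
    then show ?thesis
      unfolding eigenvalue_iff_sum[OF A] using im k(1) by (intro exI[of _ "\<lambda>j. Im (v j)"]) auto
  qed
  then show ?thesis ..
qed

definition nbs :: "'a pair_pre_digraph \<Rightarrow> 'a \<Rightarrow> 'a set" where
  "nbs G i = {j \<in> pverts G. (i, j) \<in> parcs G}"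

lemma eigenvalue_adjacency_iff:
  assumes vs: "vertex_enumeration vs G"
  shows "eigenvalue (adjacency_matrix vs G) c \<longleftrightarrow>
    (\<exists>x. (\<exists>i\<in>pverts G. x i \<noteq> 0) \<and> (\<forall>i\<in>pverts G. (\<Sum>j\<in>nbs G i. x j) = c * x i))"
proof -
  define n where "n = length vs"
  have dvs: "distinct vs" and set: "set vs = pverts G"
    using vs by (auto simp: vertex_enumeration_def)
  have bij: "bij_betw ((!) vs) {..<n} (pverts G)"
    using bij_betw_nth[OF dvs, of "{..<n}" "pverts G"] set by (simp add: n_def)
  have fin: "finite (pverts G)" using set by (metis List.finite_set)
  have row: "(\<Sum>j<n. adjacency_matrix vs G $$ (i, j) * x (vs ! j)) = (\<Sum>j\<in>nbs G (vs ! i). x j)"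
    if "i < n" for i and x :: "'a \<Rightarrow> real"
  proof -
    have "(\<Sum>j<n. adjacency_matrix vs G $$ (i, j) * x (vs ! j)) =
        (\<Sum>j<n. (if (vs ! i, vs ! j) \<in> parcs G then x (vs ! j) else 0))"
      using that by (intro sum.cong) (auto simp: adjacency_matrix_def n_def)
    also have "\<dots> = (\<Sum>j\<in>pverts G. if (vs ! i, j) \<in> parcs G then x j else 0)"
      by (rule sum.reindex_bij_betw[OF bij])
    also have "\<dots> = (\<Sum>j\<in>nbs G (vs ! i). x j)"
      using fin by (simp add: sum.If_cases nbs_def Int_def)
    finally show ?thesis .
  qed
  have all: "(\<forall>i\<in>pverts G. P i) \<longleftrightarrow> (\<forall>i<n. P (vs ! i))" and ex: "(\<exists>i\<in>pverts G. P i) \<longleftrightarrow> (\<exists>i<n. P (vs ! i))" for P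
    using bij_betw_imp_surj_on[OF bij] by (metis imageE imageI lessThan_iff)+
  have A: "adjacency_matrix vs G \<in> carrier_mat n n" by (simp add: adjacency_matrix_def n_def)
  show ?thesis
  proof
    assume "eigenvalue (adjacency_matrix vs G) c"
    then obtain x where x: "\<exists>i<n. x i \<noteq> 0"
      "\<forall>i<n. (\<Sum>j<n. adjacency_matrix vs G $$ (i, j) * x j) = c * x i"
      unfolding eigenvalue_iff_sum[OF A] by blast
    define y where "y = (\<lambda>i. x (the_inv_into {..<n} ((!) vs) i))"
    have y: "y (vs ! i) = x i" if "i < n" for i
      using bij that by (simp add: y_def bij_betw_def the_inv_into_f_f)
    have "(\<Sum>j\<in>nbs G (vs ! i). y j) = c * y (vs ! i)" if "i < n" for i
      using row[OF that, of y] x(2) that y by simp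
    then show "\<exists>x. (\<exists>i\<in>pverts G. x i \<noteq> 0) \<and> (\<forall>i\<in>pverts G. (\<Sum>j\<in>nbs G i. x j) = c * x i)"
      using x(1) y unfolding all ex by (intro exI[of _ y]) auto
  next
    assume "\<exists>x. (\<exists>i\<in>pverts G. x i \<noteq> 0) \<and> (\<forall>i\<in>pverts G. (\<Sum>j\<in>nbs G i. x j) = c * x i)"
    then obtain x where "\<exists>i<n. x (vs ! i) \<noteq> 0" "\<forall>i<n. (\<Sum>j\<in>nbs G (vs ! i). x j) = c * x (vs ! i)"
      unfolding all ex by blast
    then show "eigenvalue (adjacency_matrix vs G) c"
      unfolding eigenvalue_iff_sum[OF A] using row by (intro exI[of _ "\<lambda>i. x (vs ! i)"]) auto
  qed
qed

lemma vertex_enumeration_exists: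
  "finite (pverts G) \<Longrightarrow> \<exists>vs. vertex_enumeration vs G"
  using finite_distinct_list[of "pverts G"] by (auto simp: vertex_enumeration_def)

lemma graph_mu_eigenvector:
  assumes fin: "finite (pverts G)" and ne: "pverts G \<noteq> {}"
    and sym: "\<And>i j. (i, j) \<in> parcs G \<Longrightarrow> (j, i) \<in> parcs G"
  obtains x where "\<exists>i\<in>pverts G. x i \<noteq> 0"
    and "\<And>i. i \<in> pverts G \<Longrightarrow> (\<Sum>j\<in>nbs G i. x j) = graph_mu G * x i"
proof -
  obtain vs where vs: "vertex_enumeration vs G" using vertex_enumeration_exists[OF fin] by blast
  let ?A = "adjacency_matrix vs G"
  have A: "?A \<in> carrier_mat (length vs) (length vs)" by (simp add: adjacency_matrix_def)
  have "\<exists>c. eigenvalue ?A c"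
  proof (rule symmetric_real_eigenvalue_exists[OF A])
    show "0 < length vs" using vs ne by (auto simp: vertex_enumeration_def)
    show "?A $$ (i, j) = ?A $$ (j, i)" if "i < length vs" "j < length vs" for i j
      using that sym by (auto simp: adjacency_matrix_def)
  qed
  then have "Max (spectrum ?A) \<in> spectrum ?A"
    using card_finite_spectrum(1)[OF A] by (intro Max_in) (auto simp: spectrum_def)
  then have "eigenvalue ?A (graph_mu G)"
    by (simp add: graph_mu_eq[OF vs] spectrum_def)
  then show ?thesis
    unfolding eigenvalue_adjacency_iff[OF vs] using that by blast
qed

lemma graph_mu_ge:
  assumes fin: "finite (pverts G)" and "\<exists>i\<in>pverts G. x i \<noteq> 0"
    and "\<And>i. i \<in> pverts G \<Longrightarrow> (\<Sum>j\<in>nbs G i. x j) = c * x i"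
  shows "c \<le> graph_mu G"
proof -
  obtain vs where vs: "vertex_enumeration vs G" using vertex_enumeration_exists[OF fin] by blast
  let ?A = "adjacency_matrix vs G"
  have A: "?A \<in> carrier_mat (length vs) (length vs)" by (simp add: adjacency_matrix_def)
  have "c \<in> spectrum ?A"
    unfolding spectrum_def mem_Collect_eq eigenvalue_adjacency_iff[OF vs] using assms(2,3) by blast
  then show ?thesis
    using card_finite_spectrum(1)[OF A] by (simp add: graph_mu_eq[OF vs])
qed

section \<open>The extremal graph and squares of Hamilton cycles\<close>

text \<open>\<open>digraph_iso\<close> also asks for a map of arcs; here it is induced by the vertex
  map. The hypothesis \<open>H\<close> makes every arc of the target an image.\<close>

lemma graph_isomorphicI:
  assumes wf: "pair_wf_digraph G" and \<phi>: "bij_betw \<phi> (pverts G) (pverts H)"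
    and arcs: "\<And>a b. a \<in> pverts G \<Longrightarrow> b \<in> pverts G \<Longrightarrow> (a, b) \<in> parcs G \<longleftrightarrow> (\<phi> a, \<phi> b) \<in> parcs H"
    and H: "parcs H \<subseteq> pverts H \<times> pverts H"
  shows "graph_isomorphic G H"
proof -
  interpret pair_wf_digraph G by (rule wf)
  define h where "h = \<lparr>iso_verts = \<phi>, iso_arcs = (\<lambda>(a, b). (\<phi> a, \<phi> b)), iso_head = snd, iso_tail = fst\<rparr>"
  have img: "\<phi> ` pverts G = pverts H" and inj: "inj_on \<phi> (pverts G)"
    using \<phi> by (auto simp: bij_betw_def)
  have sub: "parcs G \<subseteq> pverts G \<times> pverts G"
    using arc_fst_in_verts arc_snd_in_verts by force
  have inj_arcs: "inj_on (\<lambda>(a, b). (\<phi> a, \<phi> b)) (parcs G)"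
    using inj sub by (auto simp: inj_on_def)
  have "(\<lambda>(a, b). (\<phi> a, \<phi> b)) ` parcs G = parcs H"
  proof
    show "(\<lambda>(a, b). (\<phi> a, \<phi> b)) ` parcs G \<subseteq> parcs H"
      using arcs sub by auto
    show "parcs H \<subseteq> (\<lambda>(a, b). (\<phi> a, \<phi> b)) ` parcs G"
    proof
      fix e assume e: "e \<in> parcs H"
      then have "fst e \<in> \<phi> ` pverts G" "snd e \<in> \<phi> ` pverts G" using H img by auto
      then obtain a b where "a \<in> pverts G" "b \<in> pverts G" "e = (\<phi> a, \<phi> b)"
        by (metis imageE prod.collapse)
      then show "e \<in> (\<lambda>(a, b). (\<phi> a, \<phi> b)) ` parcs G" using arcs e by force
    qed
  qed
  then have "with_proj H = app_iso h (with_proj G)"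
    using img by (simp add: app_iso_def h_def with_proj_def)
  moreover have "pre_digraph.digraph_isomorphism (with_proj G) h"
    using inj inj_arcs wf by (auto simp: pre_digraph.digraph_isomorphism_def h_def wf_digraph_wp_iff)
  ultimately show ?thesis
    unfolding graph_isomorphic_def digraph_iso_def by blast
qed

text \<open>Intermediate value theorem between \<open>N - 1\<close> and \<open>N\<close>. The left
  side minus the right side is \<open>- 3 / (N - 1)\<close> at the lower end, so the root lies
  strictly above it, and \<open>(N + 1) / 4 - 3 / N\<close> at the upper end.\<close>

lemma extremal_eigenvalue_exists:
  fixes N :: nat
  assumes "17 \<le> N"
  shows "\<exists>c. real N - 1 < c \<and> c = 2 + 3 / c + 3 * (real N - 3) / (c - real N + 4)"
proof -
  define f where "f c = c - 2 - 3 / c - 3 * (real N - 3) / (c - real N + 4)" for c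
  have N: "17 \<le> real N" using assms by simp
  have lo: "f (real N - 1) < 0"
    using N by (simp add: f_def field_simps)
  have hi: "0 \<le> f (real N)"
  proof -
    have "3 / real N \<le> 3 / 17" using N by (intro divide_left_mono) auto
    then show ?thesis using N by (simp add: f_def)
  qed
  have "continuous_on {real N - 1..real N} f"
    unfolding f_def using N by (intro continuous_intros) auto
  then obtain c where c: "real N - 1 \<le> c" "c \<le> real N" "f c = 0"
    using IVT'[of f "real N - 1" 0 "real N"] lo hi by auto
  have "c \<noteq> real N - 1" using lo c(3) by auto
  then show ?thesis using c by (intro exI[of _ c]) (auto simp: f_def)
qed

text \<open>The Perron vector \<open>extremal_vec\<close> takes one value on each of \<open>{v}\<close>, \<open>W\<close> and the rest; scaling
  the value on \<open>W\<close> to \<open>1\<close>, the eigenvalue equation at \<open>W\<close> is the one solved in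
  \<open>extremal_eigenvalue_exists\<close>.\<close>

definition extremal_nbs :: "'a set \<Rightarrow> 'a \<Rightarrow> 'a set \<Rightarrow> 'a \<Rightarrow> 'a set" where
  "extremal_nbs V v W i = (if i = v then W else if i \<in> W then V - {i} else V - {i, v})"

definition extremal_vec :: "nat \<Rightarrow> real \<Rightarrow> 'a \<Rightarrow> 'a set \<Rightarrow> 'a \<Rightarrow> real" where
  "extremal_vec N c v W j = (if j = v then 3 / c else if j \<in> W then 1 else 3 / (c - real N + 4))"

text \<open>With \<open>y\<close> the value on the rest, the equation at \<open>v\<close> is
  \<open>3 = c * (3 / c)\<close>, on the rest it is \<open>3 + (N - 4) * y = c * y\<close>, and on
  \<open>W\<close> it is the assumed equation for \<open>c\<close>.\<close>

lemma extremal_vec_eigen: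
  assumes fin: "finite V" and cardV: "card V = Suc N" and N: "17 \<le> N"
    and v: "v \<in> V" and W: "W \<subseteq> V - {v}" "card W = 3"
    and c: "real N - 1 < c" "c = 2 + 3 / c + 3 * (real N - 3) / (c - real N + 4)"
    and i: "i \<in> V"
  shows "(\<Sum>j\<in>extremal_nbs V v W i. extremal_vec N c v W j) = c * extremal_vec N c v W i"
proof -
  let ?z = "extremal_vec N c v W"
  define y where "y = 3 / (c - real N + 4)"
  have c0: "0 < c" "0 < c - real N + 4" using c(1) N by auto
  have y: "(c - real N + 4) * y = 3"
    using c0 nonzero_mult_div_cancel_left[of "c - real N + 4" 3] unfolding y_def times_divide_eq_right by simp
  have finW: "finite W" using W(1) fin by (meson finite_Diff finite_subset)
  have sumW: "(\<Sum>j\<in>W. ?z j) = 3"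
  proof -
    have "(\<Sum>j\<in>W. ?z j) = (\<Sum>j\<in>W. 1)"
      using W(1) by (intro sum.cong) (auto simp: extremal_vec_def)
    then show ?thesis using W(2) by simp
  qed
  have "card (V - {v} - W) = N - 3"
    using card_Diff_subset[OF finW W(1)] cardV v fin W(2) by simp
  moreover have "(\<Sum>j\<in>V - {v} - W. ?z j) = (\<Sum>j\<in>V - {v} - W. y)"
    by (intro sum.cong) (auto simp: extremal_vec_def y_def)
  ultimately have sumR: "(\<Sum>j\<in>V - {v} - W. ?z j) = (real N - 3) * y"
    using N by (simp add: of_nat_diff)
  have "(\<Sum>j\<in>V. ?z j) = ?z v + (\<Sum>j\<in>V - {v}. ?z j)"
    using fin v by (rule sum.remove)
  also have "(\<Sum>j\<in>V - {v}. ?z j) = (\<Sum>j\<in>V - {v} - W. ?z j) + (\<Sum>j\<in>W. ?z j)"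
    using fin W(1) by (intro sum.subset_diff) auto
  finally have sumV: "(\<Sum>j\<in>V. ?z j) = 3 / c + (real N - 3) * y + 3"
    using sumW sumR by (simp add: extremal_vec_def)
  have "(real N - 3) * y = 3 * (real N - 3) / (c - real N + 4)"
    unfolding y_def by (simp only: times_divide_eq_right mult.commute)
  then have c_eq: "c = 2 + 3 / c + (real N - 3) * y" using c(2) by linarith
  consider "i = v" | "i \<noteq> v" "i \<in> W" | "i \<noteq> v" "i \<notin> W" by blast
  then show ?thesis
  proof cases
    case 1
    then show ?thesis using sumW c0 by (simp add: extremal_nbs_def extremal_vec_def)
  next
    case 2
    then have "(\<Sum>j\<in>V. ?z j) = 1 + (\<Sum>j\<in>V - {i}. ?z j)"
      using sum.remove[OF fin i, of ?z] by (simp add: extremal_vec_def)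
    then show ?thesis using 2 sumV c_eq by (simp add: extremal_nbs_def) (simp add: extremal_vec_def)
  next
    case 3
    have "(\<Sum>j\<in>V. ?z j) = ?z v + (\<Sum>j\<in>V - {v}. ?z j)"
      using fin v by (rule sum.remove)
    also have "(\<Sum>j\<in>V - {v}. ?z j) = ?z i + (\<Sum>j\<in>V - {v} - {i}. ?z j)"
      using fin i 3 by (intro sum.remove) auto
    finally have "(\<Sum>j\<in>V - {v} - {i}. ?z j) = 3 + (real N - 3) * y - y"
      using sumV 3 by (simp add: extremal_vec_def y_def)
    moreover have "V - {v} - {i} = extremal_nbs V v W i" using 3 by (auto simp: extremal_nbs_def)
    moreover have "3 + (real N - 3) * y - y = c * y" using y by (simp add: algebra_simps)
    ultimately show ?thesis using 3 by (simp add: extremal_vec_def y_def)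
  qed
qed

section \<open>Hamilton cycles from cyclic orders\<close>

definition conflict :: "'a pair_pre_digraph \<Rightarrow> 'a \<Rightarrow> 'a \<Rightarrow> bool" where
  "conflict G x y \<longleftrightarrow> x \<in> pverts G \<and> y \<in> pverts G \<and> x \<noteq> y \<and> (x, y) \<notin> parcs G"

text \<open>The Hamilton cycle follows \<open>f\<close>. A walk of length two along it between
  distinct vertices cannot turn back, so it joins positions two apart; the conditions on
  \<open>f\<close> put every arc of the square into \<open>G\<close>.\<close>

lemma contains_squareI:
  assumes G: "pair_graph G" and n: "card (pverts G) = n" "5 \<le> n"
    and f: "bij_betw f {..<n} (pverts G)"
    and f1: "\<And>i. i < n \<Longrightarrow> \<not> conflict G (f i) (f ((i + 1) mod n))"
    and f2: "\<And>i. i < n \<Longrightarrow> \<not> conflict G (f i) (f ((i + 2) mod n))"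
  shows "contains_power_of_hamilton_cycle 2 G"
proof -
  interpret G: pair_graph G by (rule G)
  have sym: "(b, a) \<in> parcs G" if "(a, b) \<in> parcs G" for a b
    using that G.pair_sym_arcs by (auto simp: symmetric_def sym_def)
  have inj: "f i = f j \<longleftrightarrow> i = j" if "i < n" "j < n" for i j
    using f that by (auto simp: bij_betw_def inj_on_def)
  have fV: "f i \<in> pverts G" if "i < n" for i using bij_betwE[OF f] that by auto
  have step1: "(f i, f ((i + 1) mod n)) \<in> parcs G" and ne1: "i \<noteq> (i + 1) mod n" if "i < n" for i
  proof -
    show ne: "i \<noteq> (i + 1) mod n" using that n(2) by (cases "Suc i = n") auto
    show "(f i, f ((i + 1) mod n)) \<in> parcs G"
      using f1[OF that] fV that inj[of i "(i + 1) mod n"] ne n(2) by (auto simp: conflict_def)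
  qed
  have step2: "(f i, f ((i + 2) mod n)) \<in> parcs G" if "i < n" for i
  proof -
    have ne: "i \<noteq> (i + 2) mod n"
    proof (cases "i + 2 < n")
      case False
      then have "(i + 2) mod n = i + 2 - n" using that n(2) by (simp add: mod_if)
      then show ?thesis using that n(2) False by linarith
    qed simp
    show ?thesis
      using f2[OF that] fV that inj[of i "(i + 2) mod n"] ne n(2) by (auto simp: conflict_def)
  qed
  have succ_inj: "i = k" if "i < n" "k < n" "(i + 1) mod n = (k + 1) mod n" for i k
    using that by (auto simp: mod_Suc split: if_splits)
  define C where "C = \<lparr>pverts = pverts G, parcs = {(f i, f j) | i j. (i, j) \<in> parcs (cycle_graph n)}\<rparr>"
  have cyc: "(i, j) \<in> parcs (cycle_graph n) \<longleftrightarrow> i < n \<and> j < n \<and> (j = (i + 1) mod n \<or> i = (j + 1) mod n)" for i j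
    by (simp add: cycle_graph_def)
  have C_sub: "parcs C \<subseteq> parcs G"
    using step1 sym by (auto simp: C_def cyc)
  have C_verts: "parcs C \<subseteq> pverts C \<times> pverts C"
    using fV by (auto simp: C_def cyc)
  have wfC: "pair_wf_digraph C" using C_verts by unfold_locales auto
  have spanningI: "spanning (with_proj K) (with_proj G)"
    if "pverts K = pverts G" "parcs K \<subseteq> parcs G" for K :: "'a pair_pre_digraph"
  proof -
    have "wf_digraph (with_proj K)"
      unfolding wf_digraph_wp_iff using that G.arc_fst_in_verts G.arc_snd_in_verts
      by unfold_locales (metis subsetD)+
    moreover have "wf_digraph (with_proj G)" by unfold_locales
    ultimately show ?thesis
      using that by (auto simp: spanning_def subgraph_def compatible_def)
  qed
  have "graph_isomorphic C (cycle_graph n)"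
  proof (rule graph_isomorphicI[OF wfC])
    define \<phi> where "\<phi> = the_inv_into {..<n} f"
    have \<phi>: "\<phi> (f i) = i" if "i < n" for i
      using f that by (simp add: \<phi>_def bij_betw_def the_inv_into_f_f)
    show "bij_betw \<phi> (pverts C) (pverts (cycle_graph n))"
      unfolding \<phi>_def using bij_betw_the_inv_into[OF f] by (simp add: C_def cycle_graph_def)
    show "(a, b) \<in> parcs C \<longleftrightarrow> (\<phi> a, \<phi> b) \<in> parcs (cycle_graph n)"
      if ab: "a \<in> pverts C" "b \<in> pverts C" for a b
    proof -
      have "a \<in> f ` {..<n}" "b \<in> f ` {..<n}"
        using ab f by (auto simp: C_def bij_betw_def)
      then obtain i j where ij: "i < n" "j < n" "a = f i" "b = f j" by auto
      have "(f i, f j) \<in> parcs C \<longleftrightarrow> (i, j) \<in> parcs (cycle_graph n)"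
        using ij inj by (auto simp: C_def cyc)
      then show ?thesis using ij \<phi> by simp
    qed
  qed (auto simp: cycle_graph_def)
  then have "hamilton_cycle C G"
    using spanningI[of C] C_sub n by (simp add: hamilton_cycle_def C_def)
  moreover have "spanning (with_proj (graph_power 2 C)) (with_proj G)"
  proof (rule spanningI)
    show "pverts (graph_power 2 C) = pverts G" by (simp add: graph_power_def C_def)
    show "parcs (graph_power 2 C) \<subseteq> parcs G"
    proof (rule subrelI)
      fix u w assume "(u, w) \<in> parcs (graph_power 2 C)"
      then obtain p where uw: "u \<noteq> w" and p: "pre_digraph.awalk (with_proj C) u p w" "length p \<le> 2"
        by (auto simp: graph_power_def)
      have pc: "set p \<subseteq> parcs C" "pcas u p w"
        using p(1) by (auto simp: pre_digraph.awalk_def cas_with_proj_eq)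
      consider "p = []" | e where "p = [e]" | d e where "p = [d, e]"
        using p(2) by (metis (no_types, opaque_lifting) One_nat_def Suc_1 Suc_le_mono le_zero_eq length_0_conv length_Suc_conv list.exhaust list.size(4) add.right_neutral add_Suc_right)
      then show "(u, w) \<in> parcs G"
      proof cases
        case 1
        then show ?thesis using pc uw by simp
      next
        case (2 e)
        then have "e = (u, w)" using pc by (cases e) auto
        then show ?thesis using 2 pc C_sub by auto
      next
        case (3 d e)
        then obtain m where "d = (u, m)" "e = (m, w)" using pc by (cases d, cases e) auto
        then have "(u, m) \<in> parcs C" "(m, w) \<in> parcs C" using 3 pc by auto
        then obtain i j j' k where ij: "(i, j) \<in> parcs (cycle_graph n)" "u = f i" "m = f j"
          and jk: "(j', k) \<in> parcs (cycle_graph n)" "m = f j'" "w = f k"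
          by (auto simp: C_def)
        have lt: "i < n" "j < n" "k < n" and "j' = j"
          using ij jk inj[of j' j] by (auto simp: cyc)
        have ik: "i \<noteq> k" using uw ij jk by auto
        have add2: "((a + 1) mod n + 1) mod n = (a + 2) mod n" for a
          by (simp add: mod_Suc_eq)
        consider "j = (i + 1) mod n" "k = (j + 1) mod n" | "i = (j + 1) mod n" "j = (k + 1) mod n"
          using ij(1) jk(1) lt ik succ_inj[of i k] unfolding cyc \<open>j' = j\<close> by metis
        then show ?thesis
        proof cases
          case 1
          then have "k = (i + 2) mod n" using add2 by simp
          then show ?thesis using step2[OF lt(1)] ij jk by simp
        next
          case 2
          then have "i = (k + 2) mod n" using add2 by simp
          then show ?thesis using step2[OF lt(3)] ij jk sym by simp
        qed
      qed
    qed
  qed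
  ultimately show ?thesis unfolding contains_power_of_hamilton_cycle_def by blast
qed

section \<open>Graphs with large eigenvalue\<close>

lemma pair_graph_finite_conflict: "pair_graph G \<Longrightarrow> finite_conflict (pverts G) (conflict G)"
proof -
  assume "pair_graph G"
  then interpret G: pair_graph G .
  have "(b, a) \<in> parcs G" if "(a, b) \<in> parcs G" for a b
    using that G.pair_sym_arcs by (auto simp: symmetric_def sym_def)
  then show ?thesis
    using G.pair_finite_verts by unfold_locales (auto simp: conflict_def)
qed

text \<open>The bound \<open>mu_gt\<close> reflects that the extremal eigenvalue exceeds
  \<open>N - 1\<close>; the exact comparison with that eigenvalue enters only in
  \<open>extremal_structure\<close>.\<close>

locale large_mu_graph = pair_graph G for G :: "'a pair_pre_digraph" +
  fixes N :: nat
  assumes card_verts: "card (pverts G) = Suc N" and N17: "17 \<le> N"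
    and mu_gt: "real N - 1 < graph_mu G"
begin

abbreviation "V \<equiv> pverts G"

sublocale cf: finite_conflict V "conflict G"
  by (rule pair_graph_finite_conflict) unfold_locales

lemma nbs_eq: "i \<in> V \<Longrightarrow> nbs G i = V - {i} - cf.nb i"
  using pair_no_loops[of "(i, i)"] by (auto simp: nbs_def cf.nb_def conflict_def)

lemma nb_subset: "cf.nb i \<subseteq> V - {i}"
  by (auto simp: cf.nb_def conflict_def)

lemma nbs_subset: "nbs G i \<subseteq> V"
  by (auto simp: nbs_def)

lemma finite_nbs: "finite (nbs G i)"
  using nbs_subset pair_finite_verts by (rule finite_subset)

text \<open>The identity \<open>A = J - I - B\<close> in coordinates, with \<open>B\<close> the
  adjacency matrix of the complement and \<open>J\<close> all ones.\<close>

lemma sum_nbs: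
  fixes z :: "'a \<Rightarrow> real"
  assumes "i \<in> V"
  shows "(\<Sum>j\<in>nbs G i. z j) = (\<Sum>j\<in>V. z j) - z i - (\<Sum>j\<in>cf.nb i. z j)"
proof -
  have "(\<Sum>j\<in>V. z j) = z i + (\<Sum>j\<in>V - {i}. z j)"
    using pair_finite_verts assms by (rule sum.remove)
  also have "(\<Sum>j\<in>V - {i}. z j) = (\<Sum>j\<in>V - {i} - cf.nb i. z j) + (\<Sum>j\<in>cf.nb i. z j)"
    using pair_finite_verts nb_subset by (intro sum.subset_diff) auto
  finally show ?thesis using nbs_eq[OF assms] by simp
qed

lemma card_nbs: "i \<in> V \<Longrightarrow> card (nbs G i) + cf.dg i = N"
  using sum_nbs[of i "\<lambda>_. 1"] card_verts by (simp add: cf.dg_def)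

lemma sum_swap_nb:
  fixes h :: "'a \<Rightarrow> real"
  shows "(\<Sum>i\<in>V. \<Sum>j\<in>cf.nb i. h j) = (\<Sum>j\<in>V. real (cf.dg j) * h j)"
proof -
  have "(\<Sum>i\<in>V. \<Sum>j\<in>cf.nb i. h j) = (\<Sum>i\<in>V. \<Sum>j\<in>V. if conflict G i j then h j else 0)"
    unfolding cf.nb_def by (intro sum.cong refl sum.inter_filter pair_finite_verts)
  also have "\<dots> = (\<Sum>j\<in>V. \<Sum>i\<in>V. if conflict G i j then h j else 0)"
    by (rule sum.swap)
  also have "\<dots> = (\<Sum>j\<in>V. \<Sum>i\<in>V. if conflict G j i then h j else 0)"
    using cf.R_sym by (intro sum.cong refl) metis
  also have "\<dots> = (\<Sum>j\<in>V. \<Sum>i\<in>cf.nb j. h j)"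
    unfolding cf.nb_def by (intro sum.cong refl sum.inter_filter[symmetric] pair_finite_verts)
  also have "\<dots> = (\<Sum>j\<in>V. real (cf.dg j) * h j)"
    by (simp add: cf.dg_def)
  finally show ?thesis .
qed

lemma mu_eigenvector:
  obtains x where "\<exists>i\<in>V. x i \<noteq> 0"
    and "\<And>i. i \<in> V \<Longrightarrow> (\<Sum>j\<in>nbs G i. x j) = graph_mu G * x i"
proof (rule graph_mu_eigenvector)
  show "V \<noteq> {}" using card_verts by auto
  show "(j, i) \<in> parcs G" if "(i, j) \<in> parcs G" for i j
    using that pair_sym_arcs by (auto simp: symmetric_def sym_def)
qed (use pair_finite_verts in auto)

section \<open>Consequences of explicit supersolutions\<close>

text \<open>By \<open>perron_closed_set\<close> with \<open>c = N - 1\<close>, a positive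
  supersolution forces the eigenvalue down to \<open>N - 1\<close>.\<close>

lemma supersolution_False:
  assumes z: "\<And>i. i \<in> V \<Longrightarrow> 0 < z i"
    and super: "\<And>i. i \<in> V \<Longrightarrow> (\<Sum>j\<in>nbs G i. z j) \<le> (real N - 1) * z i"
  shows False
proof -
  obtain x where x: "\<exists>i\<in>V. x i \<noteq> 0"
    "\<And>i. i \<in> V \<Longrightarrow> (\<Sum>j\<in>nbs G i. x j) = graph_mu G * x i"
    using mu_eigenvector by blast
  have "graph_mu G = real N - 1"
    using perron_closed_set(1)[OF pair_finite_verts nbs_subset z super x(2,1)] mu_gt N17 by simp
  then show False using mu_gt by simp
qed

text \<open>A vertex isolated in \<open>G\<close> would lower every other degree to at most
  \<open>N - 1\<close>, and the all-ones vector would be a supersolution.\<close>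

lemma dg_less: "i \<in> V \<Longrightarrow> cf.dg i < N"
proof (rule ccontr)
  assume v: "i \<in> V" and "\<not> cf.dg i < N"
  then have "card (nbs G i) = 0" using card_nbs[OF v] by simp
  then have e: "nbs G i = {}" using finite_nbs by simp
  show False
  proof (rule supersolution_False[of "\<lambda>_. 1"])
    fix j assume j: "j \<in> V"
    have "card (nbs G j) \<le> N - 1"
    proof (cases "j = i")
      case False
      have "(i, j) \<notin> parcs G" using e j by (auto simp: nbs_def)
      then have "(j, i) \<notin> parcs G" using pair_sym_arcs by (auto simp: symmetric_def sym_def)
      then have "i \<in> cf.nb j" using False j v by (simp add: cf.nb_def conflict_def)
      then have "1 \<le> cf.dg j" by (auto simp: cf.dg_def Suc_le_eq card_gt_0_iff)
      then show ?thesis using card_nbs[OF j] by simp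
    qed (use e in simp)
    then have "real (card (nbs G j)) \<le> real (N - 1)" by (rule of_nat_mono)
    then show "(\<Sum>j\<in>nbs G j. 1) \<le> (real N - 1) * 1" using N17 by simp
  qed simp
qed

text \<open>The test vector \<open>d + (N - 1)\<close>, with \<open>d\<close> the degrees in \<open>G\<close>, turns a bound on the row sums of
  \<open>A\<^sup>2\<close> into a supersolution.\<close>

lemma sum_dg_le: "(\<Sum>i\<in>V. cf.dg i) \<le> 2 * (N - 1)"
proof (rule ccontr)
  assume "\<not> ?thesis"
  then have "2 * N \<le> (\<Sum>i\<in>V. cf.dg i) + 1" by simp
  then have "real (2 * N) \<le> real ((\<Sum>i\<in>V. cf.dg i) + 1)" by (rule of_nat_mono)
  then have big: "2 * real N - 1 \<le> (\<Sum>i\<in>V. real (cf.dg i))" by simp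
  show False
  proof (rule supersolution_False[of "\<lambda>i. 2 * real N - 1 - real (cf.dg i)"])
    fix i assume i: "i \<in> V"
    show "0 < 2 * real N - 1 - real (cf.dg i)" using dg_less[OF i] N17 by simp
    have d1: "1 \<le> real N - real (cf.dg j)" if "j \<in> V" for j
    proof -
      have "Suc (cf.dg j) \<le> N" using dg_less[OF that] by simp
      then have "real (Suc (cf.dg j)) \<le> real N" by (rule of_nat_mono)
      then show ?thesis by simp
    qed
    have d: "real (card (nbs G i)) = real N - real (cf.dg i)"
      using card_nbs[OF i] by (simp flip: of_nat_add)
    have "(\<Sum>j\<in>cf.nb i. 1) \<le> (\<Sum>j\<in>cf.nb i. real N - real (cf.dg j))"
      using d1 nb_subset by (intro sum_mono) auto
    then have nb: "real (cf.dg i) \<le> (\<Sum>j\<in>cf.nb i. real N - real (cf.dg j))"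
      by (simp add: cf.dg_def)
    have all: "(\<Sum>j\<in>V. real N - real (cf.dg j)) = (real N + 1) * real N - (\<Sum>j\<in>V. real (cf.dg j))"
      by (simp add: sum_subtractf card_verts)
    \<comment> \<open>The row sum at \<open>i\<close> of the squared adjacency matrix:
      \<open>big\<close> bounds the total degree, and the vertices of \<open>cf.nb i\<close> have
      degree at least 1.\<close>
    have "(\<Sum>j\<in>nbs G i. real N - real (cf.dg j)) \<le> (real N - 1) * (real N - 1)"
      using sum_nbs[OF i, of "\<lambda>j. real N - real (cf.dg j)"] nb all big by (simp add: algebra_simps)
    moreover have "(\<Sum>j\<in>nbs G i. 2 * real N - 1 - real (cf.dg j)) =
        (\<Sum>j\<in>nbs G i. real N - real (cf.dg j)) + (real N - real (cf.dg i)) * (real N - 1)"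
      unfolding d[symmetric] by (simp add: sum.distrib[symmetric] sum_subtractf algebra_simps)
    ultimately show "(\<Sum>j\<in>nbs G i. 2 * real N - 1 - real (cf.dg j)) \<le> (real N - 1) * (2 * real N - 1 - real (cf.dg i))"
      by (simp add: algebra_simps)
  qed
qed

text \<open>With \<open>A = J - I - B\<close>, the test vector is the truncated Neumann series of \<open>(N + B)\<^sup>-\<^sup>1\<close> applied
  to the all-ones vector.\<close>

lemma weight_less: "(\<Sum>i\<in>V. cf.dg i * (N - cf.dg i)) < N * N"
proof (rule ccontr)
  assume "\<not> ?thesis"
  then have "N * N \<le> (\<Sum>i\<in>V. cf.dg i * (N - cf.dg i))" by simp
  then have "real (N * N) \<le> real (\<Sum>i\<in>V. cf.dg i * (N - cf.dg i))" by (rule of_nat_mono)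
  also have "\<dots> = (\<Sum>i\<in>V. real (cf.dg i) * (real N - real (cf.dg i)))"
    using dg_less by (simp add: of_nat_diff less_imp_le)
  finally have big: "real N * real N \<le> real N * (\<Sum>i\<in>V. real (cf.dg i)) - (\<Sum>i\<in>V. real (cf.dg i) * real (cf.dg i))"
    by (simp add: algebra_simps sum_subtractf sum_distrib_left)
  define z where "z i = real N * real N - real N * real (cf.dg i) + (\<Sum>j\<in>cf.nb i. real (cf.dg j))" for i
  show False
  proof (rule supersolution_False[of z])
    fix i assume i: "i \<in> V"
    have "0 < real N * (real N - real (cf.dg i))" using dg_less[OF i] N17 by simp
    moreover have "0 \<le> (\<Sum>j\<in>cf.nb i. real (cf.dg j))" by (intro sum_nonneg) simp
    moreover have "z i = real N * (real N - real (cf.dg i)) + (\<Sum>j\<in>cf.nb i. real (cf.dg j))"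
      by (simp add: z_def algebra_simps)
    ultimately show "0 < z i" by linarith
    have "(\<Sum>j\<in>V. z j) = (real N + 1) * (real N * real N) - real N * (\<Sum>j\<in>V. real (cf.dg j)) +
        (\<Sum>j\<in>V. real (cf.dg j) * real (cf.dg j))"
      by (simp add: z_def sum.distrib sum_subtractf card_verts sum_swap_nb sum_distrib_left)
    then have 1: "(\<Sum>j\<in>V. z j) \<le> real N * (real N * real N)"
      using big by (simp add: algebra_simps)
    have "(\<Sum>j\<in>cf.nb i. z j) = real (cf.dg i) * (real N * real N) - real N * (\<Sum>j\<in>cf.nb i. real (cf.dg j)) +
        (\<Sum>j\<in>cf.nb i. \<Sum>k\<in>cf.nb j. real (cf.dg k))"
      by (simp add: z_def sum.distrib sum_subtractf cf.dg_def sum_distrib_left)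
    moreover have "0 \<le> (\<Sum>j\<in>cf.nb i. \<Sum>k\<in>cf.nb j. real (cf.dg k))" by (intro sum_nonneg) simp
    \<comment> \<open>The Neumann series telescopes: the right-hand side is \<open>N * N * N\<close>
      plus the double sum, which is non-negative.\<close>
    ultimately have 2: "real N * (real N * real N) \<le> real N * z i + (\<Sum>j\<in>cf.nb i. z j)"
      by (simp add: z_def algebra_simps)
    show "(\<Sum>j\<in>nbs G i. z j) \<le> (real N - 1) * z i"
      using sum_nbs[OF i, of z] 1 2 by (simp add: algebra_simps)
  qed
qed

text \<open>A proper closed set of size \<open>k\<close> would force \<open>k (N + 1 - k) \<ge> N\<close> edges in the complement.\<close>

lemma closed_eq_V:
  assumes Z: "Z \<subseteq> V" "Z \<noteq> {}" and closed: "\<And>i. i \<in> Z \<Longrightarrow> nbs G i \<subseteq> Z"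
  shows "Z = V"
proof (rule ccontr)
  assume "Z \<noteq> V"
  have finZ: "finite Z" using Z(1) pair_finite_verts by (rule finite_subset)
  define k where "k = card Z"
  define l where "l = card (V - Z)"
  have "0 < k" using Z(2) finZ by (simp add: k_def card_gt_0_iff)
  have "0 < l" using Z(1) \<open>Z \<noteq> V\<close> pair_finite_verts by (auto simp: l_def card_gt_0_iff)
  have kl: "k + l = Suc N"
    using card_Diff_subset[OF finZ Z(1)] card_mono[OF pair_finite_verts Z(1)] card_verts
    by (simp add: k_def l_def)
  have conf: "j \<in> cf.nb i" "i \<in> cf.nb j" if "i \<in> Z" "j \<in> V - Z" for i j
  proof -
    have "j \<notin> nbs G i" using closed that by auto
    then show "j \<in> cf.nb i" using that Z(1) by (auto simp: nbs_def cf.nb_def conflict_def)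
    then show "i \<in> cf.nb j" using that Z(1) cf.R_sym by (auto simp: cf.nb_def)
  qed
  have "l \<le> cf.dg i" if "i \<in> Z" for i
    unfolding l_def cf.dg_def using conf[OF that] by (intro card_mono) auto
  then have "k * l \<le> (\<Sum>i\<in>Z. cf.dg i)"
    using sum_bounded_below[of Z l cf.dg] by (simp add: k_def)
  moreover have "k \<le> cf.dg j" if "j \<in> V - Z" for j
    unfolding k_def cf.dg_def using conf(2)[OF _ that] by (intro card_mono) auto
  then have "l * k \<le> (\<Sum>j\<in>V - Z. cf.dg j)"
    using sum_bounded_below[of "V - Z" k cf.dg] by (simp add: l_def)
  moreover have "(\<Sum>i\<in>V. cf.dg i) = (\<Sum>i\<in>V - Z. cf.dg i) + (\<Sum>i\<in>Z. cf.dg i)"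
    using Z(1) pair_finite_verts by (rule sum.subset_diff)
  ultimately have "2 * (k * l) \<le> 2 * (N - 1)"
    using sum_dg_le by (simp add: mult.commute)
  \<comment> \<open>Then \<open>k * l = a * b + N\<close>, which exceeds
    \<open>N - 1\<close>.\<close>
  moreover obtain a b where "k = Suc a" "l = Suc b"
    using \<open>0 < k\<close> \<open>0 < l\<close> by (metis Suc_pred)
  ultimately show False using kl by simp
qed

section \<open>Rigidity in the presence of a vertex with at most three neighbours\<close>

text \<open>The at most three neighbours of \<open>v\<close> extend to \<open>W\<close>, so
  \<open>G\<close> is a spanning subgraph of the extremal graph, whose Perron vector is a
  supersolution for \<open>c\<close>. By \<open>perron_closed_set\<close> equality holds on a closed
  set, which is all of \<open>V\<close>; as the vector is positive, no arc is missing.\<close>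

lemma extremal_structure:
  assumes v: "v \<in> V" "N < cf.dg v + 4"
    and c: "real N - 1 < c" "c = 2 + 3 / c + 3 * (real N - 3) / (c - real N + 4)" "c \<le> graph_mu G"
  obtains W where "W \<subseteq> V - {v}" "card W = 3" "\<And>i. i \<in> V \<Longrightarrow> nbs G i = extremal_nbs V v W i"
proof -
  have "card (nbs G v) \<le> 3" using card_nbs[OF v(1)] v(2) by simp
  moreover have "3 \<le> card (V - {v})" using card_verts v(1) pair_finite_verts N17 by simp
  moreover have "nbs G v \<subseteq> V - {v}" using nbs_eq[OF v(1)] by auto
  ultimately obtain W where W: "nbs G v \<subseteq> W" "W \<subseteq> V - {v}" "card W = 3"
    using exists_subset_between[of "nbs G v" 3 "V - {v}"] pair_finite_verts by auto
  let ?z = "extremal_vec N c v W"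
  have sub: "nbs G i \<subseteq> extremal_nbs V v W i" if i: "i \<in> V" for i
  proof (cases "i = v \<or> i \<in> W")
    case True
    then show ?thesis using W(1) nbs_eq[OF i] by (auto simp: extremal_nbs_def)
  next
    case False
    then have "(v, i) \<notin> parcs G" using W(1) i by (auto simp: nbs_def)
    then have "(i, v) \<notin> parcs G" using pair_sym_arcs by (auto simp: symmetric_def sym_def)
    then show ?thesis using False nbs_eq[OF i] by (auto simp: extremal_nbs_def nbs_def)
  qed
  have zpos: "0 < ?z i" for i
    using c(1) N17 by (simp add: extremal_vec_def)
  have eig: "(\<Sum>j\<in>extremal_nbs V v W i. ?z j) = c * ?z i" if "i \<in> V" for i
    using extremal_vec_eigen[OF pair_finite_verts card_verts N17 v(1) W(2,3) c(1,2) that] .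
  have finE: "finite (extremal_nbs V v W i)" for i
    using W(2) pair_finite_verts by (auto simp: extremal_nbs_def intro: finite_subset)
  have super: "(\<Sum>j\<in>nbs G i. ?z j) \<le> c * ?z i" if "i \<in> V" for i
    unfolding eig[OF that, symmetric] using finE sub[OF that] zpos by (intro sum_mono2) (auto intro: less_imp_le)
  obtain x where x: "\<exists>i\<in>V. x i \<noteq> 0"
    "\<And>i. i \<in> V \<Longrightarrow> (\<Sum>j\<in>nbs G i. x j) = graph_mu G * x i"
    using mu_eigenvector by blast
  obtain Z where Z: "Z \<subseteq> V" "Z \<noteq> {}" "\<forall>i\<in>Z. nbs G i \<subseteq> Z \<and> (\<Sum>j\<in>nbs G i. ?z j) = c * ?z i"
    using perron_closed_set(2)[OF pair_finite_verts nbs_subset zpos super x(2,1) _ c(3)] c(1) N17 by auto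
  have ZV: "Z = V" using closed_eq_V[OF Z(1,2)] Z(3) by blast
  have "nbs G i = extremal_nbs V v W i" if i: "i \<in> V" for i
  proof (rule ccontr)
    assume "nbs G i \<noteq> extremal_nbs V v W i"
    then obtain j where j: "j \<in> extremal_nbs V v W i - nbs G i" using sub[OF i] by blast
    have "(\<Sum>j\<in>extremal_nbs V v W i. ?z j) = (\<Sum>j\<in>extremal_nbs V v W i - nbs G i. ?z j) + (\<Sum>j\<in>nbs G i. ?z j)"
      using finE sub[OF i] by (intro sum.subset_diff)
    moreover have "0 < (\<Sum>j\<in>extremal_nbs V v W i - nbs G i. ?z j)"
      using j zpos finE by (intro sum_pos) auto
    ultimately show False using eig[OF i] Z(3) ZV i by simp
  qed
  then show ?thesis using that W(2,3) by blast
qed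

end

section \<open>The extremal graph on the numbers below \<open>n\<close>\<close>

abbreviation extremal_graph :: "nat \<Rightarrow> nat pair_pre_digraph" where
  "extremal_graph n \<equiv> delete_edges (complete_graph n) (parcs (star_graph (n - 3)))"

lemma extremal_graph_arcs:
  "(i, j) \<in> parcs (extremal_graph n) \<longleftrightarrow>
    i < n \<and> j < n \<and> i \<noteq> j \<and> \<not> (i = 0 \<and> j < n - 3) \<and> \<not> (j = 0 \<and> i < n - 3)"
  by (auto simp: delete_edges_def complete_graph_def star_graph_def)

lemma extremal_graph_verts: "pverts (extremal_graph n) = {..<n}"
  by (simp add: delete_edges_def complete_graph_def)

text \<open>The centre 0 of the deleted star keeps exactly the neighbours \<open>n - 3\<close>,
  \<open>n - 2\<close>, \<open>n - 1\<close>.\<close>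

lemma extremal_graph_nbs:
  assumes "4 \<le> n" "i < n"
  shows "nbs (extremal_graph n) i = extremal_nbs {..<n} 0 {n - 3..<n} i"
  unfolding nbs_def extremal_graph_verts extremal_graph_arcs extremal_nbs_def using assms by auto

lemma extremal_graph_mu_ge:
  assumes N: "17 \<le> N"
    and c: "real N - 1 < c" "c = 2 + 3 / c + 3 * (real N - 3) / (c - real N + 4)"
  shows "c \<le> graph_mu (extremal_graph (Suc N))"
proof (rule graph_mu_ge)
  let ?W = "{Suc N - 3..<Suc N}"
  show "finite (pverts (extremal_graph (Suc N)))" unfolding extremal_graph_verts by simp
  show "\<exists>i\<in>pverts (extremal_graph (Suc N)). extremal_vec N c 0 ?W i \<noteq> 0"
    unfolding extremal_graph_verts using c N by (intro bexI[of _ 0]) (auto simp: extremal_vec_def)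
  fix i assume "i \<in> pverts (extremal_graph (Suc N))"
  then have i: "i < Suc N" unfolding extremal_graph_verts by simp
  show "(\<Sum>j\<in>nbs (extremal_graph (Suc N)) i. extremal_vec N c 0 ?W j) = c * extremal_vec N c 0 ?W i"
    using i N c by (subst extremal_graph_nbs) (auto intro!: extremal_vec_eigen)
qed

lemma (in large_mu_graph) isomorphic_extremal:
  assumes v: "v \<in> V" and W: "W \<subseteq> V - {v}" "card W = 3"
    and nbs: "\<And>i. i \<in> V \<Longrightarrow> nbs G i = extremal_nbs V v W i"
  shows "graph_isomorphic G (extremal_graph (Suc N))"
proof -
  let ?n = "Suc N"
  have finW: "finite W" using W(2) card.infinite by fastforce
  define U where "U = V - {v} - W"
  have "card U = N - 3"
    using card_Diff_subset[OF finW W(1)] card_verts v pair_finite_verts W(2) by (simp add: U_def)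
  then have "card U = card {1..<?n - 3}" by simp
  then obtain g where g: "bij_betw g U {1..<?n - 3}"
    using pair_finite_verts by (metis U_def finite_Diff finite_atLeastLessThan finite_same_card_bij)
  have "card W = card {?n - 3..<?n}" using W(2) N17 by simp
  then obtain h where h: "bij_betw h W {?n - 3..<?n}"
    using finW by (metis finite_atLeastLessThan finite_same_card_bij)
  \<comment> \<open>The special vertex goes to the centre 0 of the star, and \<open>W\<close> to the
    last three numbers, which lie outside the star.\<close>
  define \<phi> where "\<phi> x = (if x = v then 0 else if x \<in> W then h x else g x)" for x
  have gU: "bij_betw \<phi> U {1..<?n - 3}"
    using g by (rule bij_betw_cong[THEN iffD1, rotated]) (auto simp: \<phi>_def U_def)
  have hW: "bij_betw \<phi> W {?n - 3..<?n}"
    using h by (rule bij_betw_cong[THEN iffD1, rotated]) (use W(1) in \<open>auto simp: \<phi>_def\<close>)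
  have v0: "bij_betw \<phi> {v} {0}" by (simp add: \<phi>_def bij_betw_def)
  have "bij_betw \<phi> ({v} \<union> U \<union> W) ({0} \<union> {1..<?n - 3} \<union> {?n - 3..<?n})"
    using N17 by (intro bij_betw_combine v0 gU hW) auto
  moreover have "{v} \<union> U \<union> W = V" using v W(1) by (auto simp: U_def)
  moreover have "{0} \<union> {1..<?n - 3} \<union> {?n - 3..<?n} = {..<?n}" using N17 by auto
  ultimately have bij: "bij_betw \<phi> V {..<?n}" by simp
  have phi: "\<phi> a < ?n" "\<phi> a = 0 \<longleftrightarrow> a = v" "?n - 3 \<le> \<phi> a \<longleftrightarrow> a \<in> W" if aV: "a \<in> V" for a
  proof -
    show "\<phi> a < ?n" using bij_betwE[OF bij] aV by auto
    consider "a = v" | "a \<in> W" "a \<noteq> v" | "a \<in> U" "a \<noteq> v" "a \<notin> W" using aV by (auto simp: U_def)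
    then have "(\<phi> a = 0 \<longleftrightarrow> a = v) \<and> (?n - 3 \<le> \<phi> a \<longleftrightarrow> a \<in> W)"
    proof cases
      case 1
      then show ?thesis using N17 W(1) by (auto simp: \<phi>_def)
    next
      case 2
      then show ?thesis using bij_betwE[OF hW] N17 by force
    next
      case 3
      then show ?thesis using bij_betwE[OF gU] by force
    qed
    then show "\<phi> a = 0 \<longleftrightarrow> a = v" "?n - 3 \<le> \<phi> a \<longleftrightarrow> a \<in> W" by auto
  qed
  show ?thesis
  proof (rule graph_isomorphicI)
    show "pair_wf_digraph G" by unfold_locales
    show "bij_betw \<phi> V (pverts (extremal_graph ?n))" using bij unfolding extremal_graph_verts .
    show "parcs (extremal_graph ?n) \<subseteq> pverts (extremal_graph ?n) \<times> pverts (extremal_graph ?n)"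
    proof (rule subrelI)
      fix a b assume "(a, b) \<in> parcs (extremal_graph ?n)"
      then have "a < ?n \<and> b < ?n" unfolding extremal_graph_arcs by simp
      then show "(a, b) \<in> pverts (extremal_graph ?n) \<times> pverts (extremal_graph ?n)"
        unfolding extremal_graph_verts by simp
    qed
    fix a b assume ab: "a \<in> V" "b \<in> V"
    have "(a, b) \<in> parcs G \<longleftrightarrow> b \<in> extremal_nbs V v W a"
      using nbs[OF ab(1)] ab(2) by (auto simp: nbs_def)
    also have "\<dots> \<longleftrightarrow> a \<noteq> b \<and> \<not> (a = v \<and> b \<notin> W) \<and> \<not> (b = v \<and> a \<notin> W)"
      using ab W(1) by (auto simp: extremal_nbs_def)
    also have "\<dots> \<longleftrightarrow> (\<phi> a, \<phi> b) \<in> parcs (extremal_graph ?n)"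
    proof -
      have "\<phi> a = \<phi> b \<longleftrightarrow> a = b" using bij ab by (auto simp: bij_betw_def inj_on_def)
      then show ?thesis
        unfolding extremal_graph_arcs using phi[OF ab(1)] phi[OF ab(2)] by (auto simp: not_le[symmetric])
    qed
    finally show "(a, b) \<in> parcs G \<longleftrightarrow> (\<phi> a, \<phi> b) \<in> parcs (extremal_graph ?n)" .
  qed
qed

theorem theorem1p2:
  fixes G :: "'a pair_pre_digraph" and n :: nat
  assumes "pair_graph G"
    and "card (pverts G) = n"
    and "n \<ge> 18"
    and "graph_mu G \<ge> graph_mu (delete_edges (complete_graph n) (parcs (star_graph (n - 3))))"
    and "\<not> graph_isomorphic G (delete_edges (complete_graph n) (parcs (star_graph (n - 3))))"
  shows "contains_power_of_hamilton_cycle 2 G"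
proof -
  interpret pair_graph G by fact
  obtain N where N: "n = Suc N" "17 \<le> N" using assms(3) by (cases n) auto
  obtain c where c: "real N - 1 < c" "c = 2 + 3 / c + 3 * (real N - 3) / (c - real N + 4)"
    using extremal_eigenvalue_exists[OF N(2)] by blast
  have c_le: "c \<le> graph_mu G"
    using extremal_graph_mu_ge[OF N(2) c] assms(4) N(1) by simp
  interpret large_mu_graph G N
    using assms(2) N c(1) c_le by unfold_locales auto
  \<comment> \<open>A vertex of conflict degree above \<open>N - 4\<close> would make
    \<open>G\<close> the extremal graph; non-isomorphism is used here.\<close>
  have low: "cf.dg v + 4 \<le> N" if v: "v \<in> pverts G" for v
  proof (rule ccontr)
    assume "\<not> cf.dg v + 4 \<le> N"
    then obtain W where "W \<subseteq> V - {v}" "card W = 3" "\<And>i. i \<in> V \<Longrightarrow> nbs G i = extremal_nbs V v W i"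
      using extremal_structure[OF v _ c c_le] by (metis not_le)
    then show False using isomorphic_extremal[OF v] assms(5) N(1) by blast
  qed
  interpret sparse_conflict "pverts G" "conflict G" N
    using card_verts N(2) low weight_less sum_dg_le by unfold_locales auto
  obtain f where f: "bij_betw f {..<n} (pverts G)"
    "\<forall>i<n. \<not> conflict G (f i) (f ((i + 1) mod n)) \<and> \<not> conflict G (f i) (f ((i + 2) mod n))"
    using square_cyclic_V assms(2) unfolding square_cyclic_def by metis
  show ?thesis
    using f assms(2,3) by (intro contains_squareI[OF assms(1), of n f]) auto
qed

end
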